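(* The category $\mathrm{EQA}$ of equipped quantum spaces is equivalent to the category whose objects are pairs $(\mathbf{V},R)$, with $\mathbf{V}$ a finite dimensional $\Bbbk$-vector space and $R:\mathbf{V}^{\otimes 2}\to\mathbf{V}^{\otimes 2}$ a linear map, and whose arrows $(\mathbf{V},R)\to(\mathbf{W},S)$ are the linear maps $l:\mathbf{V}\to\mathbf{W}$ such that $l^{\otimes 2}\,R=S\,l^{\otimes 2}$.
   Context: $\Bbbk$ is $\mathbb{R}$ or $\mathbb{C}$; algebras are unital associative $\Bbbk$-algebras. For a finite dimensional vector space $\mathbf{V}$, $\mathbf{V}^{\otimes}=\bigoplus_{n\ge 0}\mathbf{V}^{\otimes n}$ is its tensor algebra, and $I[\mathbf{X}]$ is the two-sided ideal of $\mathbf{V}^{\otimes}$ generated by a subset $\mathbf{X}$. The category $\mathrm{QA}$ of quadratic algebras: objects are pairs $\mathcal{A}=(\mathbf{A}_1,\mathbf{A})$ with $\mathbf{A}$ an algebra generated by a finite dimensional subspace $\mathbf{A}_1$, such that the kernel of the canonical epimorphism $\mathbf{A}_1^{\otimes}\twoheadrightarrow\mathbf{A}$ is $I[\mathbf{R}]$ for some subspace $\mathbf{R}\subset\mathbf{A}_1^{\otimes 2}$. Arrows $\alpha:(\mathbf{A}_1,\mathbf{A})\to(\mathbf{B}_1,\mathbf{B})$ are algebra homomorphisms $\mathbf{A}\to\mathbf{B}$ which restrict to a linear map $\alpha_1:\mathbf{A}_1\to\mathbf{B}_1$. The category $\mathrm{EQA}$ of equipped quantum spaces: objects are pairs $(\mathcal{A};R)$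 with $\mathcal{A}=(\mathbf{A}_1,\mathbf{A})\in\mathrm{QA}$ and $R:\mathbf{A}_1^{\otimes 2}\to\mathbf{A}_1^{\otimes 2}$ a linear map compatible with $\mathcal{A}$, meaning $\ker[\mathbf{A}_1^{\otimes}\twoheadrightarrow\mathbf{A}]=I[\operatorname{Im}R]$. Arrows $(\mathcal{A};R)\to(\mathcal{B};S)$ are arrows $\alpha:\mathcal{A}\to\mathcal{B}$ in $\mathrm{QA}$ such that $\alpha_1^{\otimes 2}\,R=S\,\alpha_1^{\otimes 2}$. *)

theory Defs
  imports "HOL-Algebra.Algebra" "HOL-Algebra.Algebraic_Closure_Type" "HOL-Library.Poly_Mapping"
begin

section \<open>Categories and equivalences\<close>

text \<open>
  The same function can be an arrow between different pairs of objects, so composition, the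
  arrow part of a functor and so on take the objects involved as arguments:
  \<open>Comp C x y z g f\<close> is \<open>g \<circ> f\<close> for \<open>f : x \<rightarrow> y\<close> and \<open>g : y \<rightarrow> z\<close>.
\<close>

record ('o, 'a) cat =
  Obj :: "'o set"
  Hom :: "'o \<Rightarrow> 'o \<Rightarrow> 'a set"
  Ident :: "'o \<Rightarrow> 'a"
  Comp :: "'o \<Rightarrow> 'o \<Rightarrow> 'o \<Rightarrow> 'a \<Rightarrow> 'a \<Rightarrow> 'a"

locale category =
  fixes C :: "('o, 'a) cat"
  assumes Ident_Hom: "x \<in> Obj C \<Longrightarrow> Ident C x \<in> Hom C x x"
    and Comp_Hom:
      "\<lbrakk>x \<in> Obj C; y \<in> Obj C; z \<in> Obj C; f \<in> Hom C x y; g \<in> Hom C y z\<rbrakk>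
        \<Longrightarrow> Comp C x y z g f \<in> Hom C x z"
    and Comp_Ident_right:
      "\<lbrakk>x \<in> Obj C; y \<in> Obj C; f \<in> Hom C x y\<rbrakk> \<Longrightarrow> Comp C x x y f (Ident C x) = f"
    and Comp_Ident_left:
      "\<lbrakk>x \<in> Obj C; y \<in> Obj C; f \<in> Hom C x y\<rbrakk> \<Longrightarrow> Comp C x y y (Ident C y) f = f"
    and Comp_assoc:
      "\<lbrakk>w \<in> Obj C; x \<in> Obj C; y \<in> Obj C; z \<in> Obj C;
        f \<in> Hom C w x; g \<in> Hom C x y; h \<in> Hom C y z\<rbrakk>
        \<Longrightarrow> Comp C w y z h (Comp C w x y g f) = Comp C w x z (Comp C x y z h g) f"

definition is_functor ::
  "('o, 'a) cat \<Rightarrow> ('p, 'b) cat \<Rightarrow> ('o \<Rightarrow> 'p) \<Rightarrow> ('o \<Rightarrow> 'o \<Rightarrow> 'a \<Rightarrow> 'b) \<Rightarrow> bool"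
  where "is_functor C D Fo Fa \<longleftrightarrow>
    (\<forall>x\<in>Obj C. Fo x \<in> Obj D) \<and>
    (\<forall>x\<in>Obj C. \<forall>y\<in>Obj C. \<forall>f\<in>Hom C x y. Fa x y f \<in> Hom D (Fo x) (Fo y)) \<and>
    (\<forall>x\<in>Obj C. Fa x x (Ident C x) = Ident D (Fo x)) \<and>
    (\<forall>x\<in>Obj C. \<forall>y\<in>Obj C. \<forall>z\<in>Obj C. \<forall>f\<in>Hom C x y. \<forall>g\<in>Hom C y z.
      Fa x z (Comp C x y z g f) = Comp D (Fo x) (Fo y) (Fo z) (Fa y z g) (Fa x y f))"

definition is_iso :: "('o, 'a) cat \<Rightarrow> 'o \<Rightarrow> 'o \<Rightarrow> 'a \<Rightarrow> bool"
  where "is_iso C x y f \<longleftrightarrow> f \<in> Hom C x y \<and>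
    (\<exists>g\<in>Hom C y x. Comp C x y x g f = Ident C x \<and> Comp C y x y f g = Ident C y)"

definition natural_iso ::
  "('o, 'a) cat \<Rightarrow> ('p, 'b) cat \<Rightarrow> ('o \<Rightarrow> 'p) \<Rightarrow> ('o \<Rightarrow> 'o \<Rightarrow> 'a \<Rightarrow> 'b)
    \<Rightarrow> ('o \<Rightarrow> 'p) \<Rightarrow> ('o \<Rightarrow> 'o \<Rightarrow> 'a \<Rightarrow> 'b) \<Rightarrow> ('o \<Rightarrow> 'b) \<Rightarrow> bool"
  where "natural_iso C D Fo Fa Go Ga \<eta> \<longleftrightarrow>
    (\<forall>x\<in>Obj C. is_iso D (Fo x) (Go x) (\<eta> x)) \<and>
    (\<forall>x\<in>Obj C. \<forall>y\<in>Obj C. \<forall>f\<in>Hom C x y.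
      Comp D (Fo x) (Fo y) (Go y) (\<eta> y) (Fa x y f) =
      Comp D (Fo x) (Go x) (Go y) (Ga x y f) (\<eta> x))"

definition equivalent_categories :: "('o, 'a) cat \<Rightarrow> ('p, 'b) cat \<Rightarrow> bool"
  where "equivalent_categories C D \<longleftrightarrow> category C \<and> category D \<and>
    (\<exists>Fo Fa Go Ga \<eta> \<epsilon>.
      is_functor C D Fo Fa \<and> is_functor D C Go Ga \<and>
      natural_iso C C (\<lambda>x. x) (\<lambda>x y f. f)
        (\<lambda>x. Go (Fo x)) (\<lambda>x y f. Ga (Fo x) (Fo y) (Fa x y f)) \<eta> \<and>
      natural_iso D D (\<lambda>x. Fo (Go x)) (\<lambda>x y f. Fa (Go x) (Go y) (Ga x y f))
        (\<lambda>x. x) (\<lambda>x y f. f) \<epsilon>)"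


section \<open>Vector spaces and algebras\<close>

text \<open>
  A vector space is a \<open>module\<close> record over the base field; its \<open>mult\<close> and \<open>one\<close> fields carry no
  meaning. In particular a subspace \<open>W\<close> of an algebra \<open>A\<close>, seen as a vector space in its own
  right, is \<open>A\<lparr>carrier := W\<rparr>\<close>.
\<close>

abbreviation base_field :: "'k::field ring" where "base_field \<equiv> ring_of_type_algebra"

definition lin_span :: "('k::field, 'v) module \<Rightarrow> 'v set \<Rightarrow> 'v set"
  where "lin_span V S = \<Inter>{W. submodule W base_field V \<and> S \<subseteq> W}"

definition fin_dim :: "('k::field, 'v) module \<Rightarrow> bool"
  where "fin_dim V \<longleftrightarrow> module base_field V \<and>
    (\<exists>S. finite S \<and> S \<subseteq> carrier V \<and> lin_span V S = carrier V)"

definition lin_maps :: "('k::field, 'v) module \<Rightarrow> ('k, 'w) module \<Rightarrow> ('v \<Rightarrow> 'w) set"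
  where "lin_maps V W = {f \<in> carrier V \<rightarrow>\<^sub>E carrier W.
    (\<forall>x\<in>carrier V. \<forall>y\<in>carrier V. f (x \<oplus>\<^bsub>V\<^esub> y) = f x \<oplus>\<^bsub>W\<^esub> f y) \<and>
    (\<forall>c. \<forall>x\<in>carrier V. f (c \<odot>\<^bsub>V\<^esub> x) = c \<odot>\<^bsub>W\<^esub> f x)}"

text \<open>The library's \<open>algebra\<close> locale is restricted to commutative algebras.\<close>

definition assoc_algebra :: "('k::field, 'a) module \<Rightarrow> bool"
  where "assoc_algebra A \<longleftrightarrow> ring A \<and> module base_field A \<and>
    (\<forall>c. \<forall>x\<in>carrier A. \<forall>y\<in>carrier A.
      (c \<odot>\<^bsub>A\<^esub> x) \<otimes>\<^bsub>A\<^esub> y = c \<odot>\<^bsub>A\<^esub> (x \<otimes>\<^bsub>A\<^esub> y) \<and>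
      x \<otimes>\<^bsub>A\<^esub> (c \<odot>\<^bsub>A\<^esub> y) = c \<odot>\<^bsub>A\<^esub> (x \<otimes>\<^bsub>A\<^esub> y))"

definition alg_generated :: "('k::field, 'a) module \<Rightarrow> 'a set \<Rightarrow> 'a set"
  where "alg_generated A S = \<Inter>{B. subring B A \<and> submodule B base_field A \<and> S \<subseteq> B}"

definition alg_homs :: "('k::field, 'a) module \<Rightarrow> ('k, 'b) module \<Rightarrow> ('a \<Rightarrow> 'b) set"
  where "alg_homs A B = ring_hom A B \<inter> lin_maps A B"


section \<open>The tensor algebra\<close>

text \<open>
  Under concatenation lists form the free monoid, so that \<open>'v list \<Rightarrow>\<^sub>0 'k\<close> with the convolution
  product is the free associative algebra on \<open>'v\<close>.
\<close>

instantiation list :: (type) monoid_add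
begin
definition zero_list :: "'a list" where "zero_list = []"
definition plus_list :: "'a list \<Rightarrow> 'a list \<Rightarrow> 'a list" where "plus_list xs ys = xs @ ys"
instance by standard (simp_all add: zero_list_def plus_list_def)
end

definition words :: "('k::field, 'v) module \<Rightarrow> nat \<Rightarrow> 'v list set"
  where "words V n = {w \<in> lists (carrier V). length w = n}"

text \<open>
  As a vector space, \<open>word_alg V\<close> is the direct sum over \<open>n\<close> of the free vector spaces on the
  sets \<open>V\<^sup>n\<close>.
\<close>

definition word_alg :: "('k::field, 'v) module \<Rightarrow> ('k, 'v list \<Rightarrow>\<^sub>0 'k) module"
  where "word_alg V = \<lparr>carrier = {p. Poly_Mapping.keys p \<subseteq> lists (carrier V)},
    monoid.mult = (*), one = 1, ring.zero = 0, add = (+), module.smult = (\<lambda>c. Poly_Mapping.map ((*) c))\<rparr>"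

definition multilinear_relations :: "('k::field, 'v) module \<Rightarrow> ('v list \<Rightarrow>\<^sub>0 'k) set"
  where "multilinear_relations V =
    {Poly_Mapping.single (us @ [x \<oplus>\<^bsub>V\<^esub> y] @ ws) 1
       - Poly_Mapping.single (us @ [x] @ ws) 1 - Poly_Mapping.single (us @ [y] @ ws) 1
     | us x y ws. us \<in> lists (carrier V) \<and> ws \<in> lists (carrier V)
         \<and> x \<in> carrier V \<and> y \<in> carrier V} \<union>
    {Poly_Mapping.single (us @ [c \<odot>\<^bsub>V\<^esub> x] @ ws) 1 - Poly_Mapping.single (us @ [x] @ ws) c
     | us c x ws. us \<in> lists (carrier V) \<and> ws \<in> lists (carrier V) \<and> x \<in> carrier V}"

definition tensor_null :: "('k::field, 'v) module \<Rightarrow> ('v list \<Rightarrow>\<^sub>0 'k) set"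
  where "tensor_null V = lin_span (word_alg V) (multilinear_relations V)"

type_synonym ('k, 'v) tensor = "('v list \<Rightarrow>\<^sub>0 'k) set"

definition tensor_class :: "('k::field, 'v) module \<Rightarrow> ('v list \<Rightarrow>\<^sub>0 'k) \<Rightarrow> ('k, 'v) tensor"
  where "tensor_class V p = tensor_null V +>\<^bsub>word_alg V\<^esub> p"

text \<open>
  \<open>V\<^sup>\<otimes>\<^sup>n\<close> is the free vector space on \<open>V\<^sup>n\<close> modulo multilinearity. The relations are homogeneous
  in the length of words, so dividing them out for all \<open>n\<close> at once yields the direct sum of the
  \<open>V\<^sup>\<otimes>\<^sup>n\<close>, with product induced by concatenation; the \<open>n\<close>-th summand consists of the classes of
  linear combinations of words of length \<open>n\<close>.
\<close>

definition tensor_alg :: "('k::field, 'v) module \<Rightarrow> ('k, ('k, 'v) tensor) module"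
  where "tensor_alg V =
    ring.extend (word_alg V Quot tensor_null V)
      (module.fields (\<lambda>c T. \<Union>p\<in>T. tensor_class V (c \<odot>\<^bsub>word_alg V\<^esub> p)))"

definition tensor_power :: "('k::field, 'v) module \<Rightarrow> nat \<Rightarrow> ('k, ('k, 'v) tensor) module"
  where "tensor_power V n =
    (tensor_alg V)\<lparr>carrier := tensor_class V ` {p. Poly_Mapping.keys p \<subseteq> words V n}\<rparr>"

text \<open>\<open>tensor_power_map V W l n\<close> is \<open>l\<^sup>\<otimes>\<^sup>n : V\<^sup>\<otimes>\<^sup>n \<rightarrow> W\<^sup>\<otimes>\<^sup>n\<close>, for linear \<open>l : V \<rightarrow> W\<close>.\<close>

definition word_map :: "('v \<Rightarrow> 'w) \<Rightarrow> ('v list \<Rightarrow>\<^sub>0 'k::field) \<Rightarrow> ('w list \<Rightarrow>\<^sub>0 'k)"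
  where "word_map l p =
    (\<Sum>w\<in>Poly_Mapping.keys p. Poly_Mapping.single (map l w) (Poly_Mapping.lookup p w))"

definition tensor_power_map ::
  "('k::field, 'v) module \<Rightarrow> ('k, 'w) module \<Rightarrow> ('v \<Rightarrow> 'w) \<Rightarrow> nat
    \<Rightarrow> ('k, 'v) tensor \<Rightarrow> ('k, 'w) tensor"
  where "tensor_power_map V W l n =
    (\<lambda>T\<in>carrier (tensor_power V n). the_elem ((\<lambda>p. tensor_class W (word_map l p)) ` T))"

text \<open>
  \<open>canonical_map A\<close>, used on the tensor algebra of a subspace \<open>A1\<close> of \<open>A\<close>, is the algebra
  homomorphism into \<open>A\<close> extending the inclusion of \<open>A1\<close>: it multiplies out words.
\<close>

definition word_eval :: "('k::field, 'a) module \<Rightarrow> ('a list \<Rightarrow>\<^sub>0 'k) \<Rightarrow> 'a"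
  where "word_eval A p =
    (\<Oplus>\<^bsub>A\<^esub>w\<in>Poly_Mapping.keys p. Poly_Mapping.lookup p w \<odot>\<^bsub>A\<^esub> foldr (\<otimes>\<^bsub>A\<^esub>) w \<one>\<^bsub>A\<^esub>)"

definition canonical_map :: "('k::field, 'a) module \<Rightarrow> ('k, 'a) tensor \<Rightarrow> 'a"
  where "canonical_map A T = the_elem (word_eval A ` T)"

definition relation_ideal :: "('k::field, 'a) module \<Rightarrow> 'a set \<Rightarrow> ('k, 'a) tensor set"
  where "relation_ideal A A1 =
    a_kernel (tensor_alg (A\<lparr>carrier := A1\<rparr>)) A (canonical_map A)"


section \<open>Quadratic algebras and equipped quantum spaces\<close>

type_synonym ('k, 'a) qalg = "'a set \<times> ('k, 'a) module"

definition QA_Obj :: "('k::field, 'a) qalg set"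
  where "QA_Obj = {(A1, A). assoc_algebra A \<and>
    submodule A1 base_field A \<and> fin_dim (A\<lparr>carrier := A1\<rparr>) \<and>
    alg_generated A A1 = carrier A \<and>
    (\<exists>R. submodule R base_field (tensor_power (A\<lparr>carrier := A1\<rparr>) 2) \<and>
      relation_ideal A A1 = Idl\<^bsub>tensor_alg (A\<lparr>carrier := A1\<rparr>)\<^esub> R)}"

definition QA_Hom :: "('k::field, 'a) qalg \<Rightarrow> ('k, 'a) qalg \<Rightarrow> ('a \<Rightarrow> 'a) set"
  where "QA_Hom = (\<lambda>(A1, A) (B1, B). {\<alpha> \<in> alg_homs A B. \<alpha> ` A1 \<subseteq> B1})"

type_synonym ('k, 'v) tensor2_map = "('k, 'v) tensor \<Rightarrow> ('k, 'v) tensor"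

definition tensor2_endos :: "('k::field, 'v) module \<Rightarrow> ('k, 'v) tensor2_map set"
  where "tensor2_endos V = lin_maps (tensor_power V 2) (tensor_power V 2)"

definition intertwines ::
  "('k::field, 'v) module \<Rightarrow> ('k, 'v) tensor2_map
    \<Rightarrow> ('k, 'w) module \<Rightarrow> ('k, 'w) tensor2_map \<Rightarrow> ('v \<Rightarrow> 'w) \<Rightarrow> bool"
  where "intertwines V R W S l \<longleftrightarrow>
    compose (carrier (tensor_power V 2)) (tensor_power_map V W l 2) R =
    compose (carrier (tensor_power V 2)) S (tensor_power_map V W l 2)"

text \<open>
  The underlying sets of all algebras (and, below, of all vector spaces) are subsets of one
  universe, given by a type.
\<close>

type_synonym ('k, 'a) eqa = "('k, 'a) qalg \<times> ('k, 'a) tensor2_map"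

definition EQA :: "(('k::field, 'a) eqa, 'a \<Rightarrow> 'a) cat"
  where "EQA = \<lparr>
    Obj = {((A1, A), R). (A1, A) \<in> QA_Obj \<and> R \<in> tensor2_endos (A\<lparr>carrier := A1\<rparr>) \<and>
      relation_ideal A A1 = Idl\<^bsub>tensor_alg (A\<lparr>carrier := A1\<rparr>)\<^esub>
        (R ` carrier (tensor_power (A\<lparr>carrier := A1\<rparr>) 2))},
    Hom = (\<lambda>((A1, A), R) ((B1, B), S). {\<alpha> \<in> QA_Hom (A1, A) (B1, B).
      intertwines (A\<lparr>carrier := A1\<rparr>) R (B\<lparr>carrier := B1\<rparr>) S (restrict \<alpha> A1)}),
    Ident = (\<lambda>((A1, A), R). \<lambda>x\<in>carrier A. x),
    Comp = (\<lambda>((A1, A), R) y z \<beta> \<alpha>. compose (carrier A) \<beta> \<alpha>)\<rparr>"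

type_synonym ('k, 'v) vect2 = "('k, 'v) module \<times> ('k, 'v) tensor2_map"

definition Vect2 :: "(('k::field, 'v) vect2, 'v \<Rightarrow> 'v) cat"
  where "Vect2 = \<lparr>
    Obj = {(V, R). fin_dim V \<and> R \<in> tensor2_endos V},
    Hom = (\<lambda>(V, R) (W, S). {l \<in> lin_maps V W. intertwines V R W S l}),
    Ident = (\<lambda>(V, R). \<lambda>x\<in>carrier V. x),
    Comp = (\<lambda>(V, R) y z m l. compose (carrier V) m l)\<rparr>"

end

theory Submission
  imports "HOL-Analysis.Abstract_Topology_2" Defs
begin

text \<open>
  The equivalence is the functor that takes \<open>((A1, A), R)\<close> to \<open>(A1, R)\<close> and restricts homomorphisms
  to the generators. The reason is that an equipped quantum space can be recovered from \<open>(A1, R)\<close>: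
  compatibility says that \<open>A\<close> is the tensor algebra of \<open>A1\<close> modulo the ideal generated by the image
  of \<open>R\<close>. By \<open>equivalent_categories_if_fully_faithful_ess_surj\<close> it remains to see three things.

  The functor is faithful because \<open>A1\<close> generates \<open>A\<close> (\<open>generators_faithful\<close>).

  It is full because a linear map \<open>l : A1 \<rightarrow> B1\<close> extends to a homomorphism from the tensor algebra of
  \<open>A1\<close> to \<open>B\<close>, by the universal property (\<open>tensor_lift_alg_hom\<close>); when \<open>l\<close> intertwines \<open>R\<close> and \<open>S\<close>,
  this homomorphism kills the image of \<open>R\<close> and hence factors through \<open>A\<close> (\<open>generators_full\<close>).

  It is essentially surjective because \<open>(V, R)\<close> comes from the tensor algebra of \<open>V\<close> modulo the ideal
  generated by the image of \<open>R\<close>. Two points need care here. The relations have degree two, so they do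
  not identify elements of \<open>V\<close> (\<open>generator_not_in_quadratic_ideal\<close>), and \<open>V\<close> is isomorphic to the
  space of generators (\<open>EQA_Obj_of_presentation\<close>). And the quotient must be realised inside the given
  universe (\<open>realise_quotient\<close>): the tensor algebra of a finite dimensional space is a quotient of the
  space of linear combinations of countably many words (\<open>tensor_alg_lepoll\<close>), so over the real or
  the complex numbers it has at most the cardinality of the continuum.
\<close>


section \<open>Fully faithful, essentially surjective functors\<close>

lemma natural_isoI:
  assumes "\<And>x. x \<in> Obj C \<Longrightarrow> is_iso D (Fo x) (Go x) (\<eta> x)"
    and "\<And>x y f. \<lbrakk>x \<in> Obj C; y \<in> Obj C; f \<in> Hom C x y\<rbrakk> \<Longrightarrow>
      Comp D (Fo x) (Fo y) (Go y) (\<eta> y) (Fa x y f) = Comp D (Fo x) (Go x) (Go y) (Ga x y f) (\<eta> x)"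
  shows "natural_iso C D Fo Fa Go Ga \<eta>"
  using assms unfolding natural_iso_def by blast

text \<open>
  Choose for every \<open>d\<close> an object \<open>Go d\<close> and an isomorphism \<open>e d : Fo (Go d) \<rightarrow> d\<close> with inverse
  \<open>i d\<close>. Conjugation \<open>g \<mapsto> i d' \<circ> g \<circ> e d\<close> is functorial, and since \<open>Fa\<close> is bijective on arrows it
  lifts through \<open>Fa\<close> to the arrow part of the inverse functor; in the same way \<open>i (Fo x)\<close> lifts to
  the unit at \<open>x\<close>. Every identity that is needed in \<open>C\<close> is checked after applying \<open>Fa\<close>.
\<close>

lemma equivalent_categories_if_fully_faithful_ess_surj:
  assumes C: "category C" and D: "category D" and F: "is_functor C D Fo Fa"
    and faithful: "\<And>x y. \<lbrakk>x \<in> Obj C; y \<in> Obj C\<rbrakk> \<Longrightarrow> inj_on (Fa x y) (Hom C x y)"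
    and full: "\<And>x y. \<lbrakk>x \<in> Obj C; y \<in> Obj C\<rbrakk> \<Longrightarrow> Hom D (Fo x) (Fo y) \<subseteq> Fa x y ` Hom C x y"
    and ess_surj: "\<And>d. d \<in> Obj D \<Longrightarrow> \<exists>c\<in>Obj C. \<exists>e. is_iso D (Fo c) d e"
  shows "equivalent_categories C D"
proof -
  interpret C: category C by fact
  interpret D: category D by fact
  have Fo: "Fo x \<in> Obj D" if "x \<in> Obj C" for x
    using F that by (auto simp: is_functor_def)
  have Fa: "Fa x y f \<in> Hom D (Fo x) (Fo y)" if "x \<in> Obj C" "y \<in> Obj C" "f \<in> Hom C x y" for x y f
    using F that by (auto simp: is_functor_def)
  have Fa_id: "Fa x x (Ident C x) = Ident D (Fo x)" if "x \<in> Obj C" for x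
    using F that by (auto simp: is_functor_def)
  have Fa_comp: "Fa x z (Comp C x y z g f) = Comp D (Fo x) (Fo y) (Fo z) (Fa y z g) (Fa x y f)"
    if "x \<in> Obj C" "y \<in> Obj C" "z \<in> Obj C" "f \<in> Hom C x y" "g \<in> Hom C y z" for x y z f g
    using F that by (auto simp: is_functor_def)
  define P where "P x y = inv_into (Hom C x y) (Fa x y)" for x y
  have P: "P x y g \<in> Hom C x y" and FaP: "Fa x y (P x y g) = g"
    if "x \<in> Obj C" "y \<in> Obj C" "g \<in> Hom D (Fo x) (Fo y)" for x y g
    using full[of x y] that by (auto simp: P_def intro: inv_into_into f_inv_into_f)
  have eqI: "f = g" if "x \<in> Obj C" "y \<in> Obj C" "f \<in> Hom C x y" "g \<in> Hom C x y" "Fa x y f = Fa x y g"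
    for x y f g
    using faithful[of x y] that by (auto dest: inj_onD)
  obtain Go e where Go: "\<And>d. d \<in> Obj D \<Longrightarrow> Go d \<in> Obj C"
    and iso_e: "\<And>d. d \<in> Obj D \<Longrightarrow> is_iso D (Fo (Go d)) d (e d)"
    using ess_surj by metis
  define H where "H d = Fo (Go d)" for d
  have H: "H d \<in> Obj D" if "d \<in> Obj D" for d using that Fo Go by (simp add: H_def)
  have iso_e': "is_iso D (H d) d (e d)" if "d \<in> Obj D" for d using that iso_e by (simp add: H_def)
  obtain i where e: "\<And>d. d \<in> Obj D \<Longrightarrow> e d \<in> Hom D (H d) d"
    and i: "\<And>d. d \<in> Obj D \<Longrightarrow> i d \<in> Hom D d (H d)"
    and ie: "\<And>d. d \<in> Obj D \<Longrightarrow> Comp D (H d) d (H d) (i d) (e d) = Ident D (H d)"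
    and ei: "\<And>d. d \<in> Obj D \<Longrightarrow> Comp D d (H d) d (e d) (i d) = Ident D d"
    using iso_e' unfolding is_iso_def by metis
  \<comment> \<open>Conjugation by the chosen isomorphisms.\<close>
  define K where "K d d' g = Comp D (H d) d' (H d') (i d') (Comp D (H d) d d' g (e d))" for d d' g
  have K: "K d d' g \<in> Hom D (H d) (H d')" if "d \<in> Obj D" "d' \<in> Obj D" "g \<in> Hom D d d'" for d d' g
    unfolding K_def using that by (intro D.Comp_Hom[where y = d'] D.Comp_Hom[where y = d]) (auto intro: H e i)
  have eK: "Comp D (H d) (H d') d' (e d') (K d d' g) = Comp D (H d) d d' g (e d)"
    if "d \<in> Obj D" "d' \<in> Obj D" "g \<in> Hom D d d'" for d d' g
  proof -
    have ge: "Comp D (H d) d d' g (e d) \<in> Hom D (H d) d'"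
      using that by (intro D.Comp_Hom[where y = d]) (auto intro: H e)
    show ?thesis
      unfolding K_def using that ge
      by (subst D.Comp_assoc) (auto simp: ei H e i D.Comp_Ident_left)
  qed
  have Ki: "Comp D d (H d) (H d') (K d d' g) (i d) = Comp D d d' (H d') (i d') g"
    if "d \<in> Obj D" "d' \<in> Obj D" "g \<in> Hom D d d'" for d d' g
  proof -
    have ge: "Comp D (H d) d d' g (e d) \<in> Hom D (H d) d'"
      using that by (intro D.Comp_Hom[where y = d]) (auto intro: H e)
    have "Comp D d (H d) (H d') (K d d' g) (i d) =
        Comp D d d' (H d') (i d') (Comp D d (H d) d' (Comp D (H d) d d' g (e d)) (i d))"
      unfolding K_def using that ge by (subst D.Comp_assoc[of d "H d" d' "H d'"]) (auto simp: H e i)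
    also have "Comp D d (H d) d' (Comp D (H d) d d' g (e d)) (i d) = g"
      using that by (subst D.Comp_assoc[symmetric]) (auto simp: H e i ei D.Comp_Ident_right)
    finally show ?thesis .
  qed
  have K_eqI: "k = k'"
    if "d \<in> Obj D" "d' \<in> Obj D" "k \<in> Hom D d (H d')" "k' \<in> Hom D d (H d')"
      and eq: "Comp D d (H d') d' (e d') k = Comp D d (H d') d' (e d') k'" for d d' k k'
  proof -
    have "Comp D d d' (H d') (i d') (Comp D d (H d') d' (e d') k) = k" if "k \<in> Hom D d (H d')" for k
      using that \<open>d \<in> Obj D\<close> \<open>d' \<in> Obj D\<close>
      by (subst D.Comp_assoc) (auto simp: H e i ie D.Comp_Ident_left)
    then show ?thesis using that by metis
  qed
  have K_id: "K d d (Ident D d) = Ident D (H d)" if "d \<in> Obj D" for d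
    using that by (simp add: K_def D.Comp_Ident_left H e ie)
  have K_comp: "K d d'' (Comp D d d' d'' g f) = Comp D (H d) (H d') (H d'') (K d' d'' g) (K d d' f)"
    if d: "d \<in> Obj D" "d' \<in> Obj D" "d'' \<in> Obj D" and f: "f \<in> Hom D d d'" and g: "g \<in> Hom D d' d''"
    for d d' d'' f g
  proof (rule K_eqI[of _ d''])
    have gf: "Comp D d d' d'' g f \<in> Hom D d d''" using d f g by (rule D.Comp_Hom)
    show "K d d'' (Comp D d d' d'' g f) \<in> Hom D (H d) (H d'')" using K d gf by blast
    show "Comp D (H d) (H d') (H d'') (K d' d'' g) (K d d' f) \<in> Hom D (H d) (H d'')"
      using d f g by (intro D.Comp_Hom[where y = "H d'"] K H) auto
    have "Comp D (H d) (H d'') d'' (e d'') (Comp D (H d) (H d') (H d'') (K d' d'' g) (K d d' f)) =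
        Comp D (H d) (H d') d'' (Comp D (H d') d' d'' g (e d')) (K d d' f)"
      using d f g by (subst D.Comp_assoc) (auto simp: H K e eK)
    also have "\<dots> = Comp D (H d) d' d'' g (Comp D (H d) d d' f (e d))"
      using d f g by (subst D.Comp_assoc[symmetric]) (auto simp: H K e eK)
    also have "\<dots> = Comp D (H d) d d'' (Comp D d d' d'' g f) (e d)"
      using d f g by (subst D.Comp_assoc) (auto simp: H K e)
    finally show "Comp D (H d) (H d'') d'' (e d'') (K d d'' (Comp D d d' d'' g f)) =
        Comp D (H d) (H d'') d'' (e d'') (Comp D (H d) (H d') (H d'') (K d' d'' g) (K d d' f))"
      using d gf by (simp add: eK)
  qed (use d H in auto)
  define Ga where "Ga d d' g = P (Go d) (Go d') (K d d' g)" for d d' g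
  have Ga: "Ga d d' g \<in> Hom C (Go d) (Go d')" and FaGa: "Fa (Go d) (Go d') (Ga d d' g) = K d d' g"
    if "d \<in> Obj D" "d' \<in> Obj D" "g \<in> Hom D d d'" for d d' g
    using that K[OF that] by (auto simp: Ga_def H_def Go intro!: P FaP)
  define \<eta> where "\<eta> x = P x (Go (Fo x)) (i (Fo x))" for x
  have \<eta>: "\<eta> x \<in> Hom C x (Go (Fo x))" and Fa\<eta>: "Fa x (Go (Fo x)) (\<eta> x) = i (Fo x)"
    if "x \<in> Obj C" for x
    using that i[of "Fo x"] by (auto simp: \<eta>_def H_def Go Fo intro!: P FaP)
  \<comment> \<open>The inverse of the unit.\<close>
  define \<theta> where "\<theta> x = P (Go (Fo x)) x (e (Fo x))" for x
  have \<theta>: "\<theta> x \<in> Hom C (Go (Fo x)) x" and Fa\<theta>: "Fa (Go (Fo x)) x (\<theta> x) = e (Fo x)"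
    if "x \<in> Obj C" for x
    using that e[of "Fo x"] by (auto simp: \<theta>_def H_def Go Fo intro!: P FaP)
  have functor_G: "is_functor D C Go Ga"
    unfolding is_functor_def
  proof (intro conjI ballI)
    fix d assume d: "d \<in> Obj D"
    show "Go d \<in> Obj C" using d by (rule Go)
    show "Ga d d (Ident D d) = Ident C (Go d)"
      using d by (intro eqI[of "Go d" "Go d"])
        (auto simp: Go Ga FaGa Fa_id K_id D.Ident_Hom C.Ident_Hom H_def[symmetric])
  next
    fix d d' g assume "d \<in> Obj D" "d' \<in> Obj D" "g \<in> Hom D d d'"
    then show "Ga d d' g \<in> Hom C (Go d) (Go d')" by (rule Ga)
  next
    fix d d' d'' f g
    assume d: "d \<in> Obj D" "d' \<in> Obj D" "d'' \<in> Obj D" and f: "f \<in> Hom D d d'" and g: "g \<in> Hom D d' d''"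
    have "Comp D d d' d'' g f \<in> Hom D d d''" using d f g by (rule D.Comp_Hom)
    then show "Ga d d'' (Comp D d d' d'' g f) = Comp C (Go d) (Go d') (Go d'') (Ga d' d'' g) (Ga d d' f)"
      using d f g
      by (intro eqI[of "Go d" "Go d''"])
        (auto simp: Go Ga FaGa Fa_comp K_comp H_def intro: C.Comp_Hom[where y = "Go d'"])
  qed
  have nat_\<eta>: "natural_iso C C (\<lambda>x. x) (\<lambda>x y f. f)
        (\<lambda>x. Go (Fo x)) (\<lambda>x y f. Ga (Fo x) (Fo y) (Fa x y f)) \<eta>"
  proof (rule natural_isoI)
    fix x assume x: "x \<in> Obj C"
    have G: "Go (Fo x) \<in> Obj C" using x Go Fo by blast
    have "Comp C x (Go (Fo x)) x (\<theta> x) (\<eta> x) = Ident C x"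
      using x G ei[of "Fo x"]
      by (intro eqI[of x x])
        (auto simp: Fa_comp Fa_id Fa\<eta> Fa\<theta> \<eta> \<theta> Fo C.Ident_Hom H_def intro!: C.Comp_Hom[where y = "Go (Fo x)"])
    moreover have "Comp C (Go (Fo x)) x (Go (Fo x)) (\<eta> x) (\<theta> x) = Ident C (Go (Fo x))"
      using x G ie[of "Fo x"]
      by (intro eqI[of "Go (Fo x)" "Go (Fo x)"])
        (auto simp: Fa_comp Fa_id Fa\<eta> Fa\<theta> \<eta> \<theta> Fo C.Ident_Hom H_def intro!: C.Comp_Hom[where y = x])
    ultimately show "is_iso C x (Go (Fo x)) (\<eta> x)"
      using x \<eta> \<theta> unfolding is_iso_def by blast
  next
    fix x y f assume x: "x \<in> Obj C" and y: "y \<in> Obj C" and f: "f \<in> Hom C x y"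
    have G: "Go (Fo x) \<in> Obj C" "Go (Fo y) \<in> Obj C" using x y Go Fo by blast+
    have Gf: "Ga (Fo x) (Fo y) (Fa x y f) \<in> Hom C (Go (Fo x)) (Go (Fo y))"
      using x y f by (intro Ga Fa Fo)
    show "Comp C x y (Go (Fo y)) (\<eta> y) f =
        Comp C x (Go (Fo x)) (Go (Fo y)) (Ga (Fo x) (Fo y) (Fa x y f)) (\<eta> x)"
    proof (rule eqI[of x "Go (Fo y)"])
      show "Comp C x y (Go (Fo y)) (\<eta> y) f \<in> Hom C x (Go (Fo y))"
        using x y f G \<eta> by (intro C.Comp_Hom[where y = y])
      show "Comp C x (Go (Fo x)) (Go (Fo y)) (Ga (Fo x) (Fo y) (Fa x y f)) (\<eta> x) \<in> Hom C x (Go (Fo y))"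
        using x y f G \<eta> Gf by (intro C.Comp_Hom[where y = "Go (Fo x)"])
      show "Fa x (Go (Fo y)) (Comp C x y (Go (Fo y)) (\<eta> y) f) =
          Fa x (Go (Fo y)) (Comp C x (Go (Fo x)) (Go (Fo y)) (Ga (Fo x) (Fo y) (Fa x y f)) (\<eta> x))"
        using x y f G Gf \<eta> Ki[of "Fo x" "Fo y" "Fa x y f"]
        by (simp add: Fa_comp Fa\<eta> FaGa Fo Fa H_def)
    qed (use x G in auto)
  qed
  have nat_e: "natural_iso D D (\<lambda>x. Fo (Go x)) (\<lambda>x y f. Fa (Go x) (Go y) (Ga x y f))
        (\<lambda>x. x) (\<lambda>x y f. f) e"
  proof (rule natural_isoI)
    fix d d' g assume "d \<in> Obj D" "d' \<in> Obj D" "g \<in> Hom D d d'"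
    then show "Comp D (Fo (Go d)) (Fo (Go d')) d' (e d') (Fa (Go d) (Go d') (Ga d d' g)) =
        Comp D (Fo (Go d)) d d' g (e d)"
      using eK by (simp add: FaGa H_def)
  qed (rule iso_e)
  show ?thesis
    unfolding equivalent_categories_def using C D F functor_G nat_\<eta> nat_e by blast
qed


section \<open>Linear maps and algebra homomorphisms\<close>

lemma base_field_simps [simp]:
  "carrier base_field = UNIV"
  "c \<oplus>\<^bsub>base_field\<^esub> d = c + d" "c \<otimes>\<^bsub>base_field\<^esub> d = c * d"
  "\<one>\<^bsub>base_field\<^esub> = 1" "\<zero>\<^bsub>base_field\<^esub> = 0"
  by (simp_all add: ring_of_type_algebra_def)

context module begin
lemma a_inv_eq_smult: "x \<in> carrier M \<Longrightarrow> \<ominus>\<^bsub>M\<^esub> x = (\<ominus> \<one>) \<odot>\<^bsub>M\<^esub> x"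
  by (simp add: smult_l_minus)
end

lemma submodule_base_fieldI:
  assumes "module base_field V" "H \<subseteq> carrier V" "\<zero>\<^bsub>V\<^esub> \<in> H"
    "\<And>x y. x \<in> H \<Longrightarrow> y \<in> H \<Longrightarrow> x \<oplus>\<^bsub>V\<^esub> y \<in> H" "\<And>c x. x \<in> H \<Longrightarrow> c \<odot>\<^bsub>V\<^esub> x \<in> H"
  shows "submodule H base_field V"
proof -
  interpret module base_field V by fact
  show ?thesis using assms(2-)
    by (intro submoduleI) (auto simp: a_inv_eq_smult subset_iff)
qed

lemma submodule_base_fieldD:
  assumes "submodule H base_field V"
  shows "H \<subseteq> carrier V" "\<zero>\<^bsub>V\<^esub> \<in> H"
    "\<And>x y. x \<in> H \<Longrightarrow> y \<in> H \<Longrightarrow> x \<oplus>\<^bsub>V\<^esub> y \<in> H" "\<And>c x. x \<in> H \<Longrightarrow> c \<odot>\<^bsub>V\<^esub> x \<in> H"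
proof -
  interpret submodule H base_field V by fact
  show "H \<subseteq> carrier V" "\<zero>\<^bsub>V\<^esub> \<in> H"
    "\<And>x y. x \<in> H \<Longrightarrow> y \<in> H \<Longrightarrow> x \<oplus>\<^bsub>V\<^esub> y \<in> H" "\<And>c x. x \<in> H \<Longrightarrow> c \<odot>\<^bsub>V\<^esub> x \<in> H"
    using subset one_closed m_closed by auto
qed

lemma lin_span_least: "submodule H base_field V \<Longrightarrow> S \<subseteq> H \<Longrightarrow> lin_span V S \<subseteq> H"
  by (auto simp: lin_span_def)

lemma lin_span_superset: "S \<subseteq> lin_span V S"
  by (auto simp: lin_span_def)

lemma submodule_lin_span:
  assumes V: "module base_field V" and S: "S \<subseteq> carrier V"
  shows "submodule (lin_span V S) base_field V"
proof (rule submodule_base_fieldI[OF V])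
  interpret module base_field V by fact
  show "lin_span V S \<subseteq> carrier V"
    by (rule lin_span_least[OF carrier_is_submodule S])
qed (simp_all add: lin_span_def submodule_base_fieldD)

lemma lin_mapsI:
  assumes "\<And>x. x \<in> carrier V \<Longrightarrow> f x \<in> carrier W" "\<And>x. x \<notin> carrier V \<Longrightarrow> f x = undefined"
    "\<And>x y. x \<in> carrier V \<Longrightarrow> y \<in> carrier V \<Longrightarrow> f (x \<oplus>\<^bsub>V\<^esub> y) = f x \<oplus>\<^bsub>W\<^esub> f y"
    "\<And>c x. x \<in> carrier V \<Longrightarrow> f (c \<odot>\<^bsub>V\<^esub> x) = c \<odot>\<^bsub>W\<^esub> f x"
  shows "f \<in> lin_maps V W"
  using assms by (auto simp: lin_maps_def)

lemma lin_mapsD: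
  assumes "f \<in> lin_maps V W"
  shows "\<And>x. x \<in> carrier V \<Longrightarrow> f x \<in> carrier W"
    "\<And>x y. x \<in> carrier V \<Longrightarrow> y \<in> carrier V \<Longrightarrow> f (x \<oplus>\<^bsub>V\<^esub> y) = f x \<oplus>\<^bsub>W\<^esub> f y"
    "\<And>c x. x \<in> carrier V \<Longrightarrow> f (c \<odot>\<^bsub>V\<^esub> x) = c \<odot>\<^bsub>W\<^esub> f x"
    "f \<in> extensional (carrier V)"
  using assms by (auto simp: lin_maps_def PiE_def)

lemma lin_maps_zero:
  assumes "f \<in> lin_maps V W" "module base_field V" "module base_field W"
  shows "f \<zero>\<^bsub>V\<^esub> = \<zero>\<^bsub>W\<^esub>"
proof -
  interpret V: module base_field V by fact
  interpret W: module base_field W by fact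
  have "f (0 \<odot>\<^bsub>V\<^esub> \<zero>\<^bsub>V\<^esub>) = 0 \<odot>\<^bsub>W\<^esub> f \<zero>\<^bsub>V\<^esub>" using lin_mapsD(3)[OF assms(1)] V.zero_closed by blast
  then show ?thesis using lin_mapsD(1)[OF assms(1), of "\<zero>\<^bsub>V\<^esub>"] V.smult_l_null[of "\<zero>\<^bsub>V\<^esub>"] W.smult_l_null
    by simp
qed

lemma lin_maps_id: "module base_field V \<Longrightarrow> (\<lambda>x\<in>carrier V. x) \<in> lin_maps V V"
proof (rule lin_mapsI)
  assume "module base_field V"
  then interpret module base_field V .
  show "\<And>x y. x \<in> carrier V \<Longrightarrow> y \<in> carrier V \<Longrightarrow>
      (\<lambda>x\<in>carrier V. x) (x \<oplus>\<^bsub>V\<^esub> y) = (\<lambda>x\<in>carrier V. x) x \<oplus>\<^bsub>V\<^esub> (\<lambda>x\<in>carrier V. x) y"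
    "\<And>c x. x \<in> carrier V \<Longrightarrow> (\<lambda>x\<in>carrier V. x) (c \<odot>\<^bsub>V\<^esub> x) = c \<odot>\<^bsub>V\<^esub> (\<lambda>x\<in>carrier V. x) x"
    by auto
qed auto

lemma lin_maps_compose:
  assumes V: "module base_field V" and f: "f \<in> lin_maps U V" and g: "g \<in> lin_maps V W" and U: "module base_field U"
  shows "compose (carrier U) g f \<in> lin_maps U W"
proof (rule lin_mapsI)
  interpret U: module base_field U by fact
  show "\<And>x y. x \<in> carrier U \<Longrightarrow> y \<in> carrier U \<Longrightarrow>
      compose (carrier U) g f (x \<oplus>\<^bsub>U\<^esub> y) = compose (carrier U) g f x \<oplus>\<^bsub>W\<^esub> compose (carrier U) g f y"
    "\<And>c x. x \<in> carrier U \<Longrightarrow> compose (carrier U) g f (c \<odot>\<^bsub>U\<^esub> x) = c \<odot>\<^bsub>W\<^esub> compose (carrier U) g f x"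
    using lin_mapsD[OF f] lin_mapsD[OF g] by (auto simp: compose_eq)
qed (auto simp: compose_def lin_mapsD[OF f] lin_mapsD[OF g])

lemma submodule_vimage:
  assumes "f \<in> lin_maps V W" "module base_field V" "module base_field W" "submodule H base_field W"
  shows "submodule {x \<in> carrier V. f x \<in> H} base_field V"
proof -
  interpret V: module base_field V by fact
  show ?thesis
    using lin_mapsD[OF assms(1)] submodule_base_fieldD[OF assms(4)] lin_maps_zero[OF assms(1-3)] assms(2)
    by (intro submodule_base_fieldI) auto
qed

lemma submodule_image:
  assumes f: "f \<in> lin_maps V W" and V: "module base_field V" and W: "module base_field W"
  shows "submodule (f ` carrier V) base_field W"
proof (rule submodule_base_fieldI[OF W])
  interpret V: module base_field V by fact
  note f' = lin_mapsD[OF f]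
  show "f ` carrier V \<subseteq> carrier W" using f' by auto
  show "\<zero>\<^bsub>W\<^esub> \<in> f ` carrier V" using lin_maps_zero[OF f V W] by (metis V.zero_closed image_eqI)
  show "x \<oplus>\<^bsub>W\<^esub> y \<in> f ` carrier V" if "x \<in> f ` carrier V" "y \<in> f ` carrier V" for x y
    using that by (auto simp flip: f'(2))
  show "c \<odot>\<^bsub>W\<^esub> x \<in> f ` carrier V" if "x \<in> f ` carrier V" for c x
    using that by (auto simp flip: f'(3))
qed

lemma fin_dim_image:
  assumes V: "fin_dim V" and W: "module base_field W" and f: "f \<in> lin_maps V W"
    and surj: "f ` carrier V = carrier W"
  shows "fin_dim W"
proof -
  have mV: "module base_field V" using V by (simp add: fin_dim_def)
  obtain S where S: "finite S" "S \<subseteq> carrier V" "lin_span V S = carrier V"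
    using V by (auto simp: fin_dim_def)
  have "carrier W \<subseteq> H" if H: "submodule H base_field W" "f ` S \<subseteq> H" for H
  proof -
    have "lin_span V S \<subseteq> {x \<in> carrier V. f x \<in> H}"
      using H S by (intro lin_span_least submodule_vimage[OF f mV W]) auto
    then have "f ` carrier V \<subseteq> H" using S by auto
    then show ?thesis using surj by simp
  qed
  moreover have "f ` S \<subseteq> carrier W" using S surj by auto
  moreover have "lin_span W (f ` S) \<subseteq> carrier W"
    using calculation(2) W by (intro lin_span_least module.carrier_is_submodule)
  ultimately have "lin_span W (f ` S) = carrier W"
    unfolding lin_span_def by (intro equalityI) auto
  then show ?thesis
    using S \<open>f ` S \<subseteq> carrier W\<close> W unfolding fin_dim_def by blast
qed

lemma assoc_algebraD:
  assumes "assoc_algebra A"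
  shows "ring A" "module base_field A"
    "\<And>c x y. x \<in> carrier A \<Longrightarrow> y \<in> carrier A \<Longrightarrow> (c \<odot>\<^bsub>A\<^esub> x) \<otimes>\<^bsub>A\<^esub> y = c \<odot>\<^bsub>A\<^esub> (x \<otimes>\<^bsub>A\<^esub> y)"
    "\<And>c x y. x \<in> carrier A \<Longrightarrow> y \<in> carrier A \<Longrightarrow> x \<otimes>\<^bsub>A\<^esub> (c \<odot>\<^bsub>A\<^esub> y) = c \<odot>\<^bsub>A\<^esub> (x \<otimes>\<^bsub>A\<^esub> y)"
  using assms by (auto simp: assoc_algebra_def)

text \<open>
  The axioms of an algebra are equations, so they pass to images. This gives the structure of the
  tensor algebra (an image of the free algebra on words) and, later, of a copy of a quotient of it
  whose elements lie in a prescribed universe.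
\<close>

lemma assoc_algebra_image:
  fixes A :: "('k::field, 'a) module" and B :: "('k, 'b) module"
  assumes A: "assoc_algebra A"
    and carrier: "carrier B = h ` carrier A"
    and add: "\<And>x y. x \<in> carrier A \<Longrightarrow> y \<in> carrier A \<Longrightarrow> h x \<oplus>\<^bsub>B\<^esub> h y = h (x \<oplus>\<^bsub>A\<^esub> y)"
    and mult: "\<And>x y. x \<in> carrier A \<Longrightarrow> y \<in> carrier A \<Longrightarrow> h x \<otimes>\<^bsub>B\<^esub> h y = h (x \<otimes>\<^bsub>A\<^esub> y)"
    and smult: "\<And>c x. x \<in> carrier A \<Longrightarrow> c \<odot>\<^bsub>B\<^esub> h x = h (c \<odot>\<^bsub>A\<^esub> x)"
    and one: "\<one>\<^bsub>B\<^esub> = h \<one>\<^bsub>A\<^esub>" and zero: "\<zero>\<^bsub>B\<^esub> = h \<zero>\<^bsub>A\<^esub>"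
  shows "assoc_algebra B"
proof -
  interpret A: ring A by (rule assoc_algebraD[OF A])
  interpret AM: module base_field A by (rule assoc_algebraD[OF A])
  have ab: "abelian_group B"
  proof (rule abelian_groupI)
    show "\<exists>y\<in>carrier B. y \<oplus>\<^bsub>B\<^esub> x = \<zero>\<^bsub>B\<^esub>" if x: "x \<in> carrier B" for x
    proof -
      obtain a where a: "a \<in> carrier A" "x = h a" using x carrier by auto
      then have "h (\<ominus>\<^bsub>A\<^esub> a) \<oplus>\<^bsub>B\<^esub> x = \<zero>\<^bsub>B\<^esub>" by (simp add: add zero A.l_neg)
      then show ?thesis using a carrier by blast
    qed
  qed (auto simp: carrier add zero A.a_ac)
  have ring: "ring B"
  proof (rule ringI[OF ab])
    show "Group.monoid B"
      by (rule monoidI) (auto simp: carrier mult one A.m_assoc)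
  qed (auto simp: carrier add mult A.l_distr A.r_distr)
  have "module base_field B"
  proof (rule moduleI[OF _ ab])
    show "cring (base_field :: 'k ring)" by (rule cring_from_type_algebra)
  qed (use AM.smult_l_distr AM.smult_r_distr AM.smult_assoc1 AM.smult_one in
      \<open>auto simp: carrier add smult\<close>)
  then show ?thesis
    using ring assoc_algebraD(3,4)[OF A] by (auto simp: assoc_algebra_def carrier mult smult)
qed

lemma alg_homsI:
  assumes "h \<in> lin_maps A B"
    and "\<And>x y. x \<in> carrier A \<Longrightarrow> y \<in> carrier A \<Longrightarrow> h (x \<otimes>\<^bsub>A\<^esub> y) = h x \<otimes>\<^bsub>B\<^esub> h y"
    and "h \<one>\<^bsub>A\<^esub> = \<one>\<^bsub>B\<^esub>"
  shows "h \<in> alg_homs A B"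
  using assms lin_mapsD[OF assms(1)] by (auto simp: alg_homs_def intro!: ring_hom_memI)

lemma alg_homsD:
  assumes "h \<in> alg_homs A B"
  shows "h \<in> lin_maps A B" "h \<in> ring_hom A B"
    and "\<And>x y. x \<in> carrier A \<Longrightarrow> y \<in> carrier A \<Longrightarrow> h (x \<otimes>\<^bsub>A\<^esub> y) = h x \<otimes>\<^bsub>B\<^esub> h y"
    and "h \<one>\<^bsub>A\<^esub> = \<one>\<^bsub>B\<^esub>"
  using assms by (auto simp: alg_homs_def ring_hom_mult ring_hom_one)

lemma alg_homs_compose:
  assumes A: "assoc_algebra A" and B: "assoc_algebra B" and f: "f \<in> alg_homs A B" and g: "g \<in> alg_homs B C"
  shows "compose (carrier A) g f \<in> alg_homs A C"
proof (rule alg_homsI)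
  interpret A: ring A by (rule assoc_algebraD[OF A])
  show "compose (carrier A) g f \<in> lin_maps A C"
    using assms by (intro lin_maps_compose[of B]) (auto dest: assoc_algebraD alg_homsD)
  note f' = alg_homsD[OF f] and g' = alg_homsD[OF g]
  note fl = lin_mapsD[OF f'(1)]
  show "\<And>x y. x \<in> carrier A \<Longrightarrow> y \<in> carrier A \<Longrightarrow>
      compose (carrier A) g f (x \<otimes>\<^bsub>A\<^esub> y) = compose (carrier A) g f x \<otimes>\<^bsub>C\<^esub> compose (carrier A) g f y"
    using f'(3) g'(3) fl by (auto simp: compose_eq)
  show "compose (carrier A) g f \<one>\<^bsub>A\<^esub> = \<one>\<^bsub>C\<^esub>" using f'(4) g'(4) by (simp add: compose_eq)
qed

lemma lin_maps_minus:
  assumes "f \<in> lin_maps V W" "module base_field V" "module base_field W" "x \<in> carrier V" "y \<in> carrier V"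
  shows "f (x \<ominus>\<^bsub>V\<^esub> y) = f x \<ominus>\<^bsub>W\<^esub> f y"
proof -
  interpret V: module base_field V by fact
  interpret W: module base_field W by fact
  note f = lin_mapsD[OF assms(1)]
  show ?thesis using assms(4,5) f
    by (simp add: V.minus_eq W.minus_eq V.a_inv_eq_smult W.a_inv_eq_smult)
qed

lemma ideal_alg_hom_vimage:
  assumes A: "assoc_algebra A" and B: "assoc_algebra B" and h: "h \<in> alg_homs A B" and I: "ideal I B"
  shows "ideal {x \<in> carrier A. h x \<in> I} A"
proof -
  interpret ring_hom_ring A B h
    using assoc_algebraD[OF A] assoc_algebraD[OF B] alg_homsD[OF h] by (intro ring_hom_ringI2)
  show ?thesis using ideal_vimage[OF I] by simp
qed

lemma ideal_alg_hom_kernel: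
  assumes A: "assoc_algebra A" and B: "assoc_algebra B" and h: "h \<in> alg_homs A B"
  shows "ideal {x \<in> carrier A. h x = \<zero>\<^bsub>B\<^esub>} A"
  using ideal_alg_hom_vimage[OF A B h ring.zeroideal[OF assoc_algebraD(1)[OF B]]] by simp

text \<open>
  The homomorphism theorem: \<open>\<alpha> a\<close> is the value of \<open>g\<close> at any preimage of \<open>a\<close>, and two preimages
  differ by an element of the kernel of \<open>h\<close>.
\<close>

lemma alg_hom_factor:
  assumes T: "assoc_algebra T" and A: "assoc_algebra A" and B: "assoc_algebra B"
    and h: "h \<in> alg_homs T A" and surj: "h ` carrier T = carrier A" and g: "g \<in> alg_homs T B"
    and ker: "\<And>t. t \<in> carrier T \<Longrightarrow> h t = \<zero>\<^bsub>A\<^esub> \<Longrightarrow> g t = \<zero>\<^bsub>B\<^esub>"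
  obtains \<alpha> where "\<alpha> \<in> alg_homs A B" "\<And>t. t \<in> carrier T \<Longrightarrow> \<alpha> (h t) = g t"
proof -
  interpret T: ring T by (rule assoc_algebraD[OF T])
  interpret A: ring A by (rule assoc_algebraD[OF A])
  interpret B: ring B by (rule assoc_algebraD[OF B])
  interpret TM: module base_field T by (rule assoc_algebraD[OF T])
  interpret AM: module base_field A by (rule assoc_algebraD[OF A])
  note hl = alg_homsD[OF h] and gl = alg_homsD[OF g]
  note hl' = lin_mapsD[OF hl(1)] and gl' = lin_mapsD[OF gl(1)]
  define \<alpha> where "\<alpha> = (\<lambda>a\<in>carrier A. g (inv_into (carrier T) h a))"
  have \<alpha>: "\<alpha> (h t) = g t" if t: "t \<in> carrier T" for t
  proof -
    define s where "s = inv_into (carrier T) h (h t)"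
    have s: "s \<in> carrier T" "h s = h t"
      using t by (auto simp: s_def inv_into_into f_inv_into_f)
    have "h (s \<ominus>\<^bsub>T\<^esub> t) = \<zero>\<^bsub>A\<^esub>"
      using s t hl' by (simp add: lin_maps_minus[OF hl(1)] assoc_algebraD T A A.r_right_minus_eq)
    then have "g (s \<ominus>\<^bsub>T\<^esub> t) = \<zero>\<^bsub>B\<^esub>" using ker s t by simp
    then have "g s = g t"
      using s t gl' by (simp add: lin_maps_minus[OF gl(1)] assoc_algebraD T B B.r_right_minus_eq)
    then show ?thesis using t hl' by (simp add: \<alpha>_def s_def)
  qed
  have "\<alpha> \<in> alg_homs A B"
  proof (intro alg_homsI lin_mapsI)
    fix x assume x: "x \<in> carrier A"
    then obtain s where s: "s \<in> carrier T" "x = h s" using surj by auto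
    show "\<alpha> x \<in> carrier B" using s gl' by (simp add: \<alpha>)
    show "\<alpha> (c \<odot>\<^bsub>A\<^esub> x) = c \<odot>\<^bsub>B\<^esub> \<alpha> x" for c
      using s gl'(3) by (simp add: \<alpha> flip: hl'(3))
    fix y assume y: "y \<in> carrier A"
    then obtain t where t: "t \<in> carrier T" "y = h t" using surj by auto
    show "\<alpha> (x \<oplus>\<^bsub>A\<^esub> y) = \<alpha> x \<oplus>\<^bsub>B\<^esub> \<alpha> y"
      using s t gl'(2) by (simp add: \<alpha> flip: hl'(2))
    show "\<alpha> (x \<otimes>\<^bsub>A\<^esub> y) = \<alpha> x \<otimes>\<^bsub>B\<^esub> \<alpha> y"
      using s t gl(3) by (simp add: \<alpha> flip: hl(3))
  next
    show "\<alpha> \<one>\<^bsub>A\<^esub> = \<one>\<^bsub>B\<^esub>" using \<alpha>[of "\<one>\<^bsub>T\<^esub>"] hl gl by simp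
  qed (simp add: \<alpha>_def)
  with \<alpha> show thesis using that by blast
qed


section \<open>The free algebra on words\<close>

abbreviation "keys \<equiv> Poly_Mapping.keys"
abbreviation "single \<equiv> Poly_Mapping.single"

lemma word_alg_simps [simp]:
  "carrier (word_alg V) = {p. keys p \<subseteq> lists (carrier V)}"
  "p \<otimes>\<^bsub>word_alg V\<^esub> q = p * q" "\<one>\<^bsub>word_alg V\<^esub> = 1" "\<zero>\<^bsub>word_alg V\<^esub> = 0"
  "p \<oplus>\<^bsub>word_alg V\<^esub> q = p + q" "c \<odot>\<^bsub>word_alg V\<^esub> p = single [] c * p"
  by (simp_all add: word_alg_def mult_map_scale_conv_mult zero_list_def)

text \<open>
  Linear combinations are built up one monomial at a time, so a statement about additive maps needs
  to be checked on single words only.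
\<close>

lemma poly_mapping_induct_single [consumes 1, case_names zero add]:
  assumes "keys p \<subseteq> K" and zero: "P 0"
    and add: "\<And>p w a. keys p \<subseteq> K \<Longrightarrow> w \<in> K \<Longrightarrow> P p \<Longrightarrow> P (p + single w a)"
  shows "P p"
  using assms(1)
proof (induction p rule: update_induct)
  case const show ?case by (rule zero)
next
  case (update f a b)
  have "Poly_Mapping.update a b f = f + single a b"
    using update.hyps by (intro poly_mapping_eqI) (auto simp: lookup_update lookup_add lookup_single in_keys_iff)
  moreover have "keys f \<subseteq> K" "a \<in> K"
    using update.hyps update.prems by (auto simp: keys_update)
  ultimately show ?case using update.IH add by simp
qed

lemma one_poly_mapping_list: "(1 :: 'v list \<Rightarrow>\<^sub>0 'k::field) = single [] 1"
  by (metis single_one zero_list_def)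

lemma single_mult_single: "single u a * single v b = single (u @ v) (a * b)"
  by (simp add: mult_single plus_list_def)

lemma single_Nil_commute: "p * single [] c = single [] (c :: 'k::field) * p"
proof -
  have "keys p \<subseteq> UNIV" by simp
  then show ?thesis
    by (induction p rule: poly_mapping_induct_single)
      (simp_all add: distrib_left distrib_right single_mult_single mult.commute)
qed

lemma keys_uminus: "keys (- p) = keys (p :: 'a \<Rightarrow>\<^sub>0 'b::ab_group_add)"
  by (auto simp: in_keys_iff)

lemma keys_mult_lists:
  "keys p \<subseteq> lists A \<Longrightarrow> keys q \<subseteq> lists A \<Longrightarrow> keys (p * q) \<subseteq> lists A"
  using keys_mult[of p q] by (fastforce simp: plus_list_def)

lemma keys_add_subset: "keys p \<subseteq> A \<Longrightarrow> keys q \<subseteq> A \<Longrightarrow> keys (p + q) \<subseteq> A"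
  using keys_add[of p q] by blast

lemma keys_diff_subset:
  "keys (p :: 'a \<Rightarrow>\<^sub>0 'b::ab_group_add) \<subseteq> A \<Longrightarrow> keys q \<subseteq> A \<Longrightarrow> keys (p - q) \<subseteq> A"
  using keys_add_subset[of p A "- q"] by (simp add: keys_uminus)

lemma keys_scale_subset: "keys p \<subseteq> A \<Longrightarrow> keys (single [] c * p) \<subseteq> A"
  using keys_mult[of "single [] c" p] by (fastforce simp: plus_list_def split: if_splits)

lemma assoc_algebra_word_alg: "assoc_algebra (word_alg V)"
proof -
  have ab: "abelian_group (word_alg V)"
  proof (rule abelian_groupI)
    fix p assume p: "p \<in> carrier (word_alg V)"
    show "\<exists>q\<in>carrier (word_alg V). q \<oplus>\<^bsub>word_alg V\<^esub> p = \<zero>\<^bsub>word_alg V\<^esub>"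
      using p by (intro bexI[of _ "- p"]) (auto simp: keys_uminus)
  qed (auto simp: add_ac keys_add_subset)
  have ring: "ring (word_alg V)"
  proof (rule ringI[OF ab])
    show "Group.monoid (word_alg V)"
      by (rule monoidI) (simp_all add: keys_mult_lists mult.assoc zero_list_def)
  qed (simp_all add: distrib_left distrib_right)
  have "module base_field (word_alg V)"
  proof (rule moduleI[OF _ ab])
    show "cring (base_field :: 'b ring)" by (rule cring_from_type_algebra)
  qed (simp_all add: keys_scale_subset single_add distrib_left distrib_right single_mult_single
      flip: mult.assoc one_poly_mapping_list)
  moreover have "p * (single [] c * q) = single [] c * (p * q)" for p q :: "'a list \<Rightarrow>\<^sub>0 'b" and c
    by (metis mult.assoc single_Nil_commute)
  ultimately show ?thesis
    using ring by (simp add: assoc_algebra_def mult.assoc)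
qed

lemmas ring_word_alg = assoc_algebraD(1)[OF assoc_algebra_word_alg]
lemmas module_word_alg = assoc_algebraD(2)[OF assoc_algebra_word_alg]

lemma word_alg_minus: "p \<in> carrier (word_alg V) \<Longrightarrow> q \<in> carrier (word_alg V) \<Longrightarrow> p \<ominus>\<^bsub>word_alg V\<^esub> q = p - q"
proof -
  interpret ring "word_alg V" by (rule ring_word_alg)
  assume "p \<in> carrier (word_alg V)" "q \<in> carrier (word_alg V)"
  moreover have "\<ominus>\<^bsub>word_alg V\<^esub> q = - q" if "q \<in> carrier (word_alg V)"
    using that by (intro minus_equality) (auto simp: keys_uminus)
  ultimately show ?thesis by (simp add: minus_eq)
qed


section \<open>Evaluating words in an algebra\<close>

lemma word_map_add: "word_map l (p + q) = word_map l p + word_map l q"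
  unfolding word_map_def by (rule setsum_keys_plus_distrib) (simp_all add: single_add)

lemma word_map_zero [simp]: "word_map l 0 = 0"
  by (simp add: word_map_def)

lemma word_map_single: "word_map l (single w a) = single (map l w) a"
  by (simp add: word_map_def)

lemma keys_word_map: "keys (word_map l p) \<subseteq> map l ` keys p"
  unfolding word_map_def using keys_sum[of "\<lambda>w. single (map l w) (Poly_Mapping.lookup p w)" "keys p"]
  by (auto split: if_splits)

lemma word_map_cong:
  assumes "keys p \<subseteq> lists A" "\<And>x. x \<in> A \<Longrightarrow> l x = m x"
  shows "word_map l p = word_map m p"
  unfolding word_map_def using assms by (intro sum.cong refl arg_cong2[of _ _ _ _ single]) (auto simp: subset_iff)

lemma word_map_comp: "word_map m (word_map l p) = word_map (m \<circ> l) p"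
proof -
  have "keys p \<subseteq> UNIV" by simp
  then show ?thesis
    by (induction p rule: poly_mapping_induct_single) (simp_all add: word_map_add word_map_single comp_def)
qed

lemma word_map_id: "word_map (\<lambda>x. x) p = p"
proof -
  have "keys p \<subseteq> UNIV" by simp
  then show ?thesis
    by (induction p rule: poly_mapping_induct_single) (simp_all add: word_map_add word_map_single)
qed

lemma keys_word_map_lists:
  "keys p \<subseteq> lists A \<Longrightarrow> l ` A \<subseteq> B \<Longrightarrow> keys (word_map l p) \<subseteq> lists B"
  using keys_word_map[of l p] by (fastforce simp: subset_iff)

lemma keys_word_map_words:
  "keys p \<subseteq> words V n \<Longrightarrow> l ` carrier V \<subseteq> carrier W \<Longrightarrow> keys (word_map l p) \<subseteq> words W n"
  using keys_word_map[of l p] by (fastforce simp: subset_iff words_def)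

context
  fixes A :: "('k::field, 'a) module"
  assumes A: "assoc_algebra A"
begin

interpretation R: ring A by (rule assoc_algebraD[OF A])
interpretation L: module base_field A by (rule assoc_algebraD[OF A])

lemma foldr_mult_closed: "w \<in> lists (carrier A) \<Longrightarrow> foldr (\<otimes>\<^bsub>A\<^esub>) w \<one>\<^bsub>A\<^esub> \<in> carrier A"
  by (induction w) auto

lemma foldr_mult_append:
  "u \<in> lists (carrier A) \<Longrightarrow> v \<in> lists (carrier A) \<Longrightarrow>
    foldr (\<otimes>\<^bsub>A\<^esub>) (u @ v) \<one>\<^bsub>A\<^esub> = foldr (\<otimes>\<^bsub>A\<^esub>) u \<one>\<^bsub>A\<^esub> \<otimes>\<^bsub>A\<^esub> foldr (\<otimes>\<^bsub>A\<^esub>) v \<one>\<^bsub>A\<^esub>"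
  by (induction u) (auto simp: foldr_mult_closed R.m_assoc simp del: foldr_append)

text \<open>
  Summing over a common finite set of words, instead of the support of each argument, is what makes
  additivity provable: the support of a sum may be smaller than the union of the supports.
\<close>

lemma word_eval_superset:
  assumes "finite K" "keys p \<subseteq> K" "K \<subseteq> lists (carrier A)"
  shows "word_eval A p =
    (\<Oplus>\<^bsub>A\<^esub>w\<in>K. Poly_Mapping.lookup p w \<odot>\<^bsub>A\<^esub> foldr (\<otimes>\<^bsub>A\<^esub>) w \<one>\<^bsub>A\<^esub>)"
  unfolding word_eval_def
proof (rule R.add.finprod_mono_neutral_cong_left[OF assms(1,2)])
  fix w assume "w \<in> K - keys p"
  then have "w \<in> lists (carrier A)" "Poly_Mapping.lookup p w = 0"
    using assms(3) by (auto simp: in_keys_iff)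
  then show "Poly_Mapping.lookup p w \<odot>\<^bsub>A\<^esub> foldr (\<otimes>\<^bsub>A\<^esub>) w \<one>\<^bsub>A\<^esub> = \<zero>\<^bsub>A\<^esub>"
    using L.smult_l_null[OF foldr_mult_closed] by simp
qed (use assms(3) in \<open>auto intro!: L.smult_closed foldr_mult_closed\<close>)

lemma word_eval_closed: "keys p \<subseteq> lists (carrier A) \<Longrightarrow> word_eval A p \<in> carrier A"
  unfolding word_eval_def by (intro R.finsum_closed) (auto intro!: L.smult_closed foldr_mult_closed)

lemma word_eval_add:
  assumes p: "keys p \<subseteq> lists (carrier A)" and q: "keys q \<subseteq> lists (carrier A)"
  shows "word_eval A (p + q) = word_eval A p \<oplus>\<^bsub>A\<^esub> word_eval A q"
proof -
  define K where "K = keys p \<union> keys q"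
  have K: "finite K" "K \<subseteq> lists (carrier A)" "keys p \<subseteq> K" "keys q \<subseteq> K" "keys (p + q) \<subseteq> K"
    using p q keys_add[of p q] by (auto simp: K_def)
  let ?e = "\<lambda>p w. Poly_Mapping.lookup p w \<odot>\<^bsub>A\<^esub> foldr (\<otimes>\<^bsub>A\<^esub>) w \<one>\<^bsub>A\<^esub>"
  have e: "?e p \<in> K \<rightarrow> carrier A" for p
    using K(2) by (auto intro!: L.smult_closed foldr_mult_closed)
  have "(\<Oplus>\<^bsub>A\<^esub>w\<in>K. ?e (p + q) w) = (\<Oplus>\<^bsub>A\<^esub>w\<in>K. ?e p w \<oplus>\<^bsub>A\<^esub> ?e q w)"
  proof (rule R.finsum_cong')
    show "?e (p + q) w = ?e p w \<oplus>\<^bsub>A\<^esub> ?e q w" if "w \<in> K" for w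
      using that K(2) L.smult_l_distr[of "Poly_Mapping.lookup p w" "Poly_Mapping.lookup q w"]
      by (auto simp: lookup_add foldr_mult_closed subset_iff)
    show "(\<lambda>w. ?e p w \<oplus>\<^bsub>A\<^esub> ?e q w) \<in> K \<rightarrow> carrier A"
      using e[of p] e[of q] by (simp add: Pi_iff)
  qed simp
  also have "\<dots> = (\<Oplus>\<^bsub>A\<^esub>w\<in>K. ?e p w) \<oplus>\<^bsub>A\<^esub> (\<Oplus>\<^bsub>A\<^esub>w\<in>K. ?e q w)"
    using e[of p] e[of q] by (rule R.finsum_addf)
  finally show ?thesis using K by (simp add: word_eval_superset[of K])
qed

lemma word_eval_single:
  assumes "w \<in> lists (carrier A)"
  shows "word_eval A (single w a) = a \<odot>\<^bsub>A\<^esub> foldr (\<otimes>\<^bsub>A\<^esub>) w \<one>\<^bsub>A\<^esub>"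
  using assms foldr_mult_closed[OF assms] by (subst word_eval_superset[of "{w}"]) auto

lemma word_eval_zero: "word_eval A 0 = \<zero>\<^bsub>A\<^esub>"
  by (simp add: word_eval_def)

lemma word_eval_mult:
  assumes p: "keys p \<subseteq> lists (carrier A)" and q: "keys q \<subseteq> lists (carrier A)"
  shows "word_eval A (p * q) = word_eval A p \<otimes>\<^bsub>A\<^esub> word_eval A q"
  using p
proof (induction p rule: poly_mapping_induct_single)
  case zero
  then show ?case by (simp add: word_eval_zero word_eval_closed q)
next
  case (add p u a)
  have "word_eval A (single u a * q) = word_eval A (single u a) \<otimes>\<^bsub>A\<^esub> word_eval A q"
    using q
  proof (induction q rule: poly_mapping_induct_single)
    case zero
    then show ?case using add by (simp add: word_eval_zero word_eval_closed)
  next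
    case (add q v b)
    have uv: "foldr (\<otimes>\<^bsub>A\<^esub>) u \<one>\<^bsub>A\<^esub> \<in> carrier A" "foldr (\<otimes>\<^bsub>A\<^esub>) v \<one>\<^bsub>A\<^esub> \<in> carrier A"
      using add \<open>u \<in> _\<close> by (simp_all add: foldr_mult_closed)
    have "word_eval A (single u a * single v b) = word_eval A (single u a) \<otimes>\<^bsub>A\<^esub> word_eval A (single v b)"
      using add \<open>u \<in> _\<close> uv
      by (simp add: single_mult_single word_eval_single foldr_mult_append assoc_algebraD(3,4)[OF A]
          L.smult_assoc1[symmetric, simplified] mult.commute del: foldr_append)
    then show ?case
      using add \<open>u \<in> _\<close>
      by (simp add: distrib_left word_eval_add word_eval_closed R.r_distr keys_mult_lists)
  qed
  then show ?case
    using add q by (simp add: distrib_right word_eval_add word_eval_closed R.l_distr keys_mult_lists)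
qed

lemma word_eval_alg_hom: "(\<lambda>p\<in>carrier (word_alg A). word_eval A p) \<in> alg_homs (word_alg A) A"
proof (intro alg_homsI lin_mapsI)
  have one: "word_eval A (single [] c) = c \<odot>\<^bsub>A\<^esub> \<one>\<^bsub>A\<^esub>" for c
    by (simp add: word_eval_single)
  then show "(\<lambda>p\<in>carrier (word_alg A). word_eval A p) \<one>\<^bsub>word_alg A\<^esub> = \<one>\<^bsub>A\<^esub>"
    using L.smult_one[of "\<one>\<^bsub>A\<^esub>"] by (simp add: one_poly_mapping_list)
  show "(\<lambda>p\<in>carrier (word_alg A). word_eval A p) (c \<odot>\<^bsub>word_alg A\<^esub> p) =
      c \<odot>\<^bsub>A\<^esub> (\<lambda>p\<in>carrier (word_alg A). word_eval A p) p" if "p \<in> carrier (word_alg A)" for c p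
    using that
    by (simp add: word_eval_mult one word_eval_closed keys_scale_subset assoc_algebraD(3)[OF A])
qed (simp_all add: word_eval_add word_eval_mult word_eval_closed keys_add_subset keys_mult_lists)

lemma word_eval_in_subalgebra:
  assumes B: "subring B A" "submodule B base_field A" and S: "S \<subseteq> B" and p: "keys p \<subseteq> lists S"
  shows "word_eval A p \<in> B"
  using p
proof (induction p rule: poly_mapping_induct_single)
  case zero
  then show ?case using submodule_base_fieldD[OF B(2)] by (simp add: word_eval_zero)
next
  case (add p w a)
  interpret B: subring B A by fact
  have SA: "S \<subseteq> carrier A" using S B.subset by auto
  have "foldr (\<otimes>\<^bsub>A\<^esub>) w \<one>\<^bsub>A\<^esub> \<in> B" using \<open>w \<in> lists S\<close> S by (induction w) auto
  moreover have "w \<in> lists (carrier A)" "keys p \<subseteq> lists (carrier A)" using add SA by auto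
  ultimately show ?case
    using add submodule_base_fieldD[OF B(2)] by (simp add: word_eval_add word_eval_single)
qed

end


section \<open>The tensor algebra\<close>

lemma multilinear_relations_subset:
  assumes "module base_field V"
  shows "multilinear_relations V \<subseteq> carrier (word_alg V)"
proof -
  interpret module base_field V by fact
  show ?thesis
    unfolding multilinear_relations_def
    by (safe; simp only: word_alg_simps mem_Collect_eq; intro keys_diff_subset; auto)
qed

lemma tensor_null_submodule: "module base_field V \<Longrightarrow> submodule (tensor_null V) base_field (word_alg V)"
  unfolding tensor_null_def by (intro submodule_lin_span module_word_alg multilinear_relations_subset)

lemma tensor_null_add_rel:
  "\<lbrakk>us \<in> lists (carrier V); ws \<in> lists (carrier V); x \<in> carrier V; y \<in> carrier V\<rbrakk> \<Longrightarrow>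
    single (us @ [x \<oplus>\<^bsub>V\<^esub> y] @ ws) 1 - single (us @ [x] @ ws) 1 - single (us @ [y] @ ws) 1 \<in> tensor_null V"
  unfolding tensor_null_def multilinear_relations_def
  by (rule subsetD[OF lin_span_superset]) blast

lemma tensor_null_smult_rel:
  "\<lbrakk>us \<in> lists (carrier V); ws \<in> lists (carrier V); x \<in> carrier V\<rbrakk> \<Longrightarrow>
    single (us @ [c \<odot>\<^bsub>V\<^esub> x] @ ws) 1 - single (us @ [x] @ ws) c \<in> tensor_null V"
  unfolding tensor_null_def multilinear_relations_def
  by (rule subsetD[OF lin_span_superset]) blast

lemma tensor_null_induct:
  assumes "submodule H base_field (word_alg V)"
    and "\<And>us ws x y. \<lbrakk>us \<in> lists (carrier V); ws \<in> lists (carrier V); x \<in> carrier V; y \<in> carrier V\<rbrakk> \<Longrightarrow>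
      single (us @ [x \<oplus>\<^bsub>V\<^esub> y] @ ws) 1 - single (us @ [x] @ ws) 1 - single (us @ [y] @ ws) 1 \<in> H"
    and "\<And>us ws x c. \<lbrakk>us \<in> lists (carrier V); ws \<in> lists (carrier V); x \<in> carrier V\<rbrakk> \<Longrightarrow>
      single (us @ [c \<odot>\<^bsub>V\<^esub> x] @ ws) 1 - single (us @ [x] @ ws) c \<in> H"
  shows "tensor_null V \<subseteq> H"
  unfolding tensor_null_def multilinear_relations_def
  by (rule lin_span_least[OF assms(1)]) (use assms(2,3) in blast)

text \<open>
  Multiplying a multilinearity relation by a word on the left or on the right yields a
  multilinearity relation again, because the relations allow arbitrary words around the letter that
  varies. Hence the span of the relations is a two-sided ideal.
\<close>

lemma tensor_null_word_mult:
  fixes V :: "('k::field, 'v) module"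
  assumes V: "module base_field V" and w: "w \<in> lists (carrier V)" and n: "n \<in> tensor_null V"
  shows "single w 1 * n \<in> tensor_null V" and "n * single w 1 \<in> tensor_null V"
proof -
  note N = submodule_base_fieldD[OF tensor_null_submodule[OF V]]
  have w': "keys (single w (1::'k)) \<subseteq> lists (carrier V)" using w by simp
  have left: "single w 1 * (single [] c * p) = single [] c * (single w 1 * p)"
    for c and p :: "'v list \<Rightarrow>\<^sub>0 'k"
    by (simp add: single_mult_single flip: mult.assoc)
  let ?L = "{p \<in> carrier (word_alg V). single w 1 * p \<in> tensor_null V}"
  let ?R = "{p \<in> carrier (word_alg V). p * single w 1 \<in> tensor_null V}"
  have rel: "tensor_null V \<subseteq> carrier (word_alg V)" by (rule N(1))
  have L: "submodule ?L base_field (word_alg V)"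
    using N by (intro submodule_base_fieldI[OF module_word_alg])
      (simp_all add: distrib_left left keys_add_subset keys_scale_subset Collect_mono)
  have R: "submodule ?R base_field (word_alg V)"
    using N by (intro submodule_base_fieldI[OF module_word_alg])
      (simp_all add: distrib_right mult.assoc keys_add_subset keys_scale_subset Collect_mono)
  have add: "single w 1 * (single (us @ [x \<oplus>\<^bsub>V\<^esub> y] @ ws) 1 - single (us @ [x] @ ws) 1 - single (us @ [y] @ ws) 1) \<in> tensor_null V"
    "(single (us @ [x \<oplus>\<^bsub>V\<^esub> y] @ ws) 1 - single (us @ [x] @ ws) 1 - single (us @ [y] @ ws) 1) * single w 1 \<in> tensor_null V"
    if "us \<in> lists (carrier V)" "ws \<in> lists (carrier V)" "x \<in> carrier V" "y \<in> carrier V" for us ws x y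
    using that w tensor_null_add_rel[of "w @ us" V ws x y] tensor_null_add_rel[of us V "ws @ w" x y]
    by (simp_all add: right_diff_distrib left_diff_distrib single_mult_single)
  have smult: "single w 1 * (single (us @ [c \<odot>\<^bsub>V\<^esub> x] @ ws) 1 - single (us @ [x] @ ws) c) \<in> tensor_null V"
    "(single (us @ [c \<odot>\<^bsub>V\<^esub> x] @ ws) 1 - single (us @ [x] @ ws) c) * single w 1 \<in> tensor_null V"
    if "us \<in> lists (carrier V)" "ws \<in> lists (carrier V)" "x \<in> carrier V" for us ws x c
    using that w tensor_null_smult_rel[of "w @ us" V ws x c] tensor_null_smult_rel[of us V "ws @ w" x c]
    by (simp_all add: right_diff_distrib left_diff_distrib single_mult_single)
  have "tensor_null V \<subseteq> ?L"
    by (rule tensor_null_induct[OF L];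
        intro CollectI conjI subsetD[OF rel] tensor_null_add_rel tensor_null_smult_rel add smult)
  moreover have "tensor_null V \<subseteq> ?R"
    by (rule tensor_null_induct[OF R];
        intro CollectI conjI subsetD[OF rel] tensor_null_add_rel tensor_null_smult_rel add smult)
  ultimately show "single w 1 * n \<in> tensor_null V" "n * single w 1 \<in> tensor_null V" using n by auto
qed

lemma tensor_null_ideal:
  fixes V :: "('k::field, 'v) module"
  assumes V: "module base_field V"
  shows "ideal (tensor_null V) (word_alg V)"
proof (rule idealI[OF ring_word_alg])
  note N = submodule_base_fieldD[OF tensor_null_submodule[OF V], simplified]
  show "subgroup (tensor_null V) (add_monoid (word_alg V))"
    using tensor_null_submodule[OF V] by (rule submodule.axioms)
  have scale: "single w c = single [] c * single w 1" for w and c :: 'k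
    by (simp add: single_mult_single)
  fix n p assume n: "n \<in> tensor_null V" and "p \<in> carrier (word_alg V)"
  then have "keys p \<subseteq> lists (carrier V)" by simp
  then have "p * n \<in> tensor_null V \<and> n * p \<in> tensor_null V"
  proof (induction p rule: poly_mapping_induct_single)
    case (add p w c)
    have "single w c * n = single [] c * (single w 1 * n)"
      unfolding scale[of w c] by (rule mult.assoc)
    moreover have "n * single w c = (single [] c * n) * single w 1"
      unfolding scale[of w c] mult.assoc[symmetric] by (simp only: single_Nil_commute)
    ultimately have "single w c * n = single [] c * (single w 1 * n)" "n * single w c = single [] c * (n * single w 1)"
      by (simp_all only: mult.assoc)
    then show ?case
      using add N tensor_null_word_mult[OF V _ n] by (simp add: distrib_left distrib_right)
  qed (simp add: N)
  then show "p \<otimes>\<^bsub>word_alg V\<^esub> n \<in> tensor_null V" "n \<otimes>\<^bsub>word_alg V\<^esub> p \<in> tensor_null V" by simp_all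
qed

context
  fixes V :: "('k::field, 'v) module"
  assumes V: "module base_field V"
begin

interpretation W: ring "word_alg V" by (rule ring_word_alg)
interpretation N: ideal "tensor_null V" "word_alg V" by (rule tensor_null_ideal[OF V])

lemma tensor_class_eq_iff:
  "p \<in> carrier (word_alg V) \<Longrightarrow> q \<in> carrier (word_alg V) \<Longrightarrow>
    tensor_class V p = tensor_class V q \<longleftrightarrow> p - q \<in> tensor_null V"
  using W.quotient_eq_iff_same_a_r_cos[OF N.is_ideal, of p q]
  unfolding tensor_class_def by (simp add: word_alg_minus)

lemma mem_tensor_class_iff:
  "p \<in> carrier (word_alg V) \<Longrightarrow>
    q \<in> tensor_class V p \<longleftrightarrow> q \<in> carrier (word_alg V) \<and> tensor_class V q = tensor_class V p"
  using N.a_repr_independence'[of q p] N.a_rcos_self[of q] W.a_r_coset_subset_G[OF N.a_subset, of p]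
  unfolding tensor_class_def by blast

lemma tensor_alg_simps:
  "carrier (tensor_alg V) = tensor_class V ` carrier (word_alg V)"
  "\<one>\<^bsub>tensor_alg V\<^esub> = tensor_class V 1" "\<zero>\<^bsub>tensor_alg V\<^esub> = tensor_class V 0"
  and tensor_class_mult: "\<And>p q. p \<in> carrier (word_alg V) \<Longrightarrow> q \<in> carrier (word_alg V) \<Longrightarrow>
    tensor_class V p \<otimes>\<^bsub>tensor_alg V\<^esub> tensor_class V q = tensor_class V (p * q)"
  and tensor_class_add: "\<And>p q. p \<in> carrier (word_alg V) \<Longrightarrow> q \<in> carrier (word_alg V) \<Longrightarrow>
    tensor_class V p \<oplus>\<^bsub>tensor_alg V\<^esub> tensor_class V q = tensor_class V (p + q)"
  using N.rcoset_mult_add N.a_rcos_sum N.a_rcos_const[OF N.zero_closed]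
  by (auto simp: tensor_alg_def ring.defs FactRing_def A_RCOSETS_def RCOSETS_def tensor_class_def a_r_coset_def)

lemma tensor_class_smult:
  assumes p: "p \<in> carrier (word_alg V)"
  shows "c \<odot>\<^bsub>tensor_alg V\<^esub> tensor_class V p = tensor_class V (single [] c * p)"
proof -
  have "tensor_class V (single [] c * q) = tensor_class V (single [] c * p)" if "q \<in> tensor_class V p" for q
  proof -
    have "q \<in> carrier (word_alg V) \<and> tensor_class V q = tensor_class V p"
      using that p by (simp only: mem_tensor_class_iff)
    then have q: "q \<in> carrier (word_alg V)" "q - p \<in> tensor_null V"
      using p tensor_class_eq_iff by blast+
    have "single [] c * q - single [] c * p = single [] c * (q - p)"
      by (simp add: right_diff_distrib)
    also have "\<dots> \<in> tensor_null V"
      using submodule_base_fieldD(4)[OF tensor_null_submodule[OF V] q(2)] by simp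
    finally show ?thesis
      using p q by (subst tensor_class_eq_iff) (simp_all add: keys_scale_subset)
  qed
  moreover have "tensor_class V p \<noteq> {}" using p mem_tensor_class_iff[of p p] by blast
  ultimately have "(\<Union>q\<in>tensor_class V p. tensor_class V (single [] c * q)) = tensor_class V (single [] c * p)"
    by (intro SUP_eq_const)
  then show ?thesis by (simp add: tensor_alg_def ring.defs module.defs)
qed

lemma assoc_algebra_tensor_alg: "assoc_algebra (tensor_alg V)"
  by (rule assoc_algebra_image[OF assoc_algebra_word_alg[of V], where h = "tensor_class V"])
    (simp_all only: word_alg_simps(2-) tensor_alg_simps tensor_class_mult tensor_class_add tensor_class_smult)

lemma tensor_gen_lin_map: "(\<lambda>x\<in>carrier V. tensor_class V (single [x] 1)) \<in> lin_maps V (tensor_alg V)"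
proof -
  interpret M: module base_field V by (rule V)
  have add: "single [x \<oplus>\<^bsub>V\<^esub> y] 1 - (single [x] 1 + single [y] 1) \<in> tensor_null V"
    if "x \<in> carrier V" "y \<in> carrier V" for x y
    using tensor_null_add_rel[of "[]" V "[]" x y] that by (simp add: diff_diff_eq)
  have smult: "single [c \<odot>\<^bsub>V\<^esub> x] 1 - single [] c * single [x] 1 \<in> tensor_null V"
    if "x \<in> carrier V" for x c
    using tensor_null_smult_rel[of "[]" V "[]" x c] that by (simp add: single_mult_single)
  show ?thesis
  proof (rule lin_mapsI)
    fix x y c assume x: "x \<in> carrier V" and y: "y \<in> carrier V"
    then have "tensor_class V (single [x \<oplus>\<^bsub>V\<^esub> y] 1) = tensor_class V (single [x] 1 + single [y] 1)"
      using add[OF x y] by (subst tensor_class_eq_iff) (simp_all add: keys_add_subset)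
    then show "(\<lambda>x\<in>carrier V. tensor_class V (single [x] 1)) (x \<oplus>\<^bsub>V\<^esub> y) =
        (\<lambda>x\<in>carrier V. tensor_class V (single [x] 1)) x \<oplus>\<^bsub>tensor_alg V\<^esub>
        (\<lambda>x\<in>carrier V. tensor_class V (single [x] 1)) y"
      using x y by (simp add: tensor_class_add)
  next
    fix x c assume x: "x \<in> carrier V"
    then have "tensor_class V (single [c \<odot>\<^bsub>V\<^esub> x] 1) = tensor_class V (single [] c * single [x] 1)"
      using smult[OF x] by (subst tensor_class_eq_iff) (simp_all add: single_mult_single)
    then show "(\<lambda>x\<in>carrier V. tensor_class V (single [x] 1)) (c \<odot>\<^bsub>V\<^esub> x) =
        c \<odot>\<^bsub>tensor_alg V\<^esub> (\<lambda>x\<in>carrier V. tensor_class V (single [x] 1)) x"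
      using x by (simp add: tensor_class_smult)
  qed (simp_all add: tensor_alg_simps)
qed

end


section \<open>The universal property\<close>

lemma word_map_mult: "word_map l (p * q) = word_map l p * word_map l q"
proof -
  have "keys p \<subseteq> UNIV" by simp
  then show ?thesis
  proof (induction p rule: poly_mapping_induct_single)
    case (add p u a)
    have "keys q \<subseteq> UNIV" by simp
    then have "word_map l (single u a * q) = single (map l u) a * word_map l q"
      by (induction q rule: poly_mapping_induct_single)
        (simp_all add: word_map_add word_map_single distrib_left single_mult_single)
    then show ?case using add by (simp add: word_map_add word_map_single distrib_right)
  qed simp
qed

lemma word_lift_alg_hom:
  assumes B: "assoc_algebra B" and f: "f ` carrier V \<subseteq> carrier B"
  shows "(\<lambda>p\<in>carrier (word_alg V). word_eval B (word_map f p)) \<in> alg_homs (word_alg V) B"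
proof -
  note E = alg_homsD[OF word_eval_alg_hom[OF B]]
  note E' = lin_mapsD[OF E(1)]
  have f': "keys (word_map f p) \<subseteq> lists (carrier B)" if "keys p \<subseteq> lists (carrier V)" for p
    using that f by (rule keys_word_map_lists)
  show ?thesis
  proof (intro alg_homsI lin_mapsI)
    fix p c assume p: "p \<in> carrier (word_alg V)"
    show "(\<lambda>p\<in>carrier (word_alg V). word_eval B (word_map f p)) (c \<odot>\<^bsub>word_alg V\<^esub> p) =
        c \<odot>\<^bsub>B\<^esub> (\<lambda>p\<in>carrier (word_alg V). word_eval B (word_map f p)) p"
      using p E'(3)[of "word_map f p" c] f'[of p]
      by (simp add: keys_scale_subset word_map_mult word_map_single)
  next
    show "(\<lambda>p\<in>carrier (word_alg V). word_eval B (word_map f p)) \<one>\<^bsub>word_alg V\<^esub> = \<one>\<^bsub>B\<^esub>"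
      using E(4) by (simp add: one_poly_mapping_list word_map_single)
  qed (simp_all add: f' keys_add_subset keys_mult_lists word_map_add word_map_mult
      word_eval_add[OF B] word_eval_mult[OF B] word_eval_closed[OF B])
qed

lemma word_eval_generator:
  assumes "assoc_algebra B" "x \<in> carrier B"
  shows "word_eval B (single [x] 1) = x"
proof -
  interpret R: ring B by (rule assoc_algebraD[OF assms(1)])
  interpret L: module base_field B by (rule assoc_algebraD[OF assms(1)])
  show ?thesis using assms L.smult_one[of x] by (simp add: word_eval_single)
qed

text \<open>
  In an algebra the product of the letters of a word is multilinear in the letters, so a linear map
  \<open>f\<close> from \<open>V\<close> into an algebra sends all multilinearity relations to zero. This is the existence
  half of the universal property of the tensor algebra.
\<close>

lemma tensor_null_lift:
  fixes V :: "('k::field, 'v) module" and B :: "('k, 'b) module"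
  assumes V: "module base_field V" and B: "assoc_algebra B" and f: "f \<in> lin_maps V B"
    and n: "n \<in> tensor_null V"
  shows "word_eval B (word_map f n) = \<zero>\<^bsub>B\<^esub>"
proof -
  interpret V: module base_field V by (rule V)
  interpret R: ring B by (rule assoc_algebraD[OF B])
  interpret L: module base_field B by (rule assoc_algebraD[OF B])
  note f' = lin_mapsD[OF f]
  have fB: "f ` carrier V \<subseteq> carrier B" using f' by auto
  define E where "E = (\<lambda>p\<in>carrier (word_alg V). word_eval B (word_map f p))"
  have E: "E \<in> alg_homs (word_alg V) B"
    unfolding E_def by (rule word_lift_alg_hom[OF B fB])
  note E' = alg_homsD[OF E]
  note E'' = lin_mapsD[OF E'(1)]
  have minus: "E (p - q) = E p \<ominus>\<^bsub>B\<^esub> E q"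
    if "p \<in> carrier (word_alg V)" "q \<in> carrier (word_alg V)" for p q
    using lin_maps_minus[OF E'(1) module_word_alg assoc_algebraD(2)[OF B] that] that
    by (simp add: word_alg_minus)
  define m where "m u = E (single u 1)" for u
  have m: "m u \<in> carrier B" if "u \<in> lists (carrier V)" for u
    using that by (simp add: m_def E'')
  \<comment> \<open>Isolates one letter: \<open>us @ [x] @ ws\<close> is the product of \<open>us\<close>, \<open>x\<close> and \<open>ws\<close> in the free algebra.\<close>
  have letter: "E (single (us @ [x] @ ws) c) = m us \<otimes>\<^bsub>B\<^esub> (c \<odot>\<^bsub>B\<^esub> f x) \<otimes>\<^bsub>B\<^esub> m ws"
    if u: "us \<in> lists (carrier V)" "ws \<in> lists (carrier V)" and x: "x \<in> carrier V" for us ws x c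
  proof -
    have "single (us @ [x] @ ws) c = single us 1 * (single [] c * single [x] 1) * single ws 1"
      by (simp add: single_mult_single)
    moreover have "E (single [x] 1) = f x"
      using x f' word_eval_generator[OF B] by (simp add: E_def word_map_single)
    ultimately show ?thesis
      using u x E'(3)[of "single us 1 * (single [] c * single [x] 1)" "single ws 1"]
        E'(3)[of "single us 1" "single [] c * single [x] 1"] E''(3)[of "single [x] 1" c]
      by (simp add: m_def keys_mult_lists)
  qed
  have zero: "submodule {\<zero>\<^bsub>B\<^esub>} base_field B"
    by (rule submodule_base_fieldI[OF assoc_algebraD(2)[OF B]]) auto
  have "tensor_null V \<subseteq> {p \<in> carrier (word_alg V). E p \<in> {\<zero>\<^bsub>B\<^esub>}}"
  proof (rule tensor_null_induct[OF submodule_vimage[OF E'(1) module_word_alg assoc_algebraD(2)[OF B] zero]])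
    fix us ws x y
    assume u: "us \<in> lists (carrier V)" "ws \<in> lists (carrier V)" and x: "x \<in> carrier V" and y: "y \<in> carrier V"
    let ?p = "single (us @ [x \<oplus>\<^bsub>V\<^esub> y] @ ws) (1::'k)"
    let ?q = "single (us @ [x] @ ws) (1::'k)" and ?r = "single (us @ [y] @ ws) (1::'k)"
    have k: "?p \<in> carrier (word_alg V)" "?q \<in> carrier (word_alg V)" "?r \<in> carrier (word_alg V)"
      using u x y by auto
    have pq: "?p - ?q \<in> carrier (word_alg V)" and pqr: "?p - ?q - ?r \<in> carrier (word_alg V)"
      using k by (simp_all only: word_alg_simps mem_Collect_eq keys_diff_subset)
    have Eqr: "E ?q \<in> carrier B" "E ?r \<in> carrier B" using k E'' by blast+
    have "E ?p = E ?q \<oplus>\<^bsub>B\<^esub> E ?r"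
      using u x y m f' L.smult_one
      by (simp add: letter[simplified] R.r_distr R.l_distr)
    then have "E (?p - ?q - ?r) = (E ?q \<oplus>\<^bsub>B\<^esub> E ?r) \<ominus>\<^bsub>B\<^esub> E ?q \<ominus>\<^bsub>B\<^esub> E ?r"
      by (simp only: minus k pq)
    also have "(E ?q \<oplus>\<^bsub>B\<^esub> E ?r) \<ominus>\<^bsub>B\<^esub> E ?q = E ?r"
      using Eqr by (metis R.a_comm R.add.inv_solve_right' R.add.m_closed R.minus_eq)
    also have "E ?r \<ominus>\<^bsub>B\<^esub> E ?r = \<zero>\<^bsub>B\<^esub>" using Eqr by simp
    finally show "?p - ?q - ?r \<in> {p \<in> carrier (word_alg V). E p \<in> {\<zero>\<^bsub>B\<^esub>}}" using pqr by blast
  next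
    fix us ws x c
    assume u: "us \<in> lists (carrier V)" "ws \<in> lists (carrier V)" and x: "x \<in> carrier V"
    let ?p = "single (us @ [c \<odot>\<^bsub>V\<^esub> x] @ ws) (1::'k)" and ?q = "single (us @ [x] @ ws) c"
    have k: "?p \<in> carrier (word_alg V)" "?q \<in> carrier (word_alg V)"
      using u x by auto
    have pq: "?p - ?q \<in> carrier (word_alg V)"
      using k by (simp_all only: word_alg_simps mem_Collect_eq keys_diff_subset)
    have Eq: "E ?q \<in> carrier B" using k E'' by blast
    have "E ?p = E ?q"
      using u x m f' L.smult_one by (simp add: letter[simplified])
    then have "E (?p - ?q) = \<zero>\<^bsub>B\<^esub>" using Eq by (simp only: minus k) simp
    then show "?p - ?q \<in> {p \<in> carrier (word_alg V). E p \<in> {\<zero>\<^bsub>B\<^esub>}}" using pq by blast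
  qed
  then have "n \<in> carrier (word_alg V)" "E n = \<zero>\<^bsub>B\<^esub>" using n by auto
  then show ?thesis by (simp add: E_def)
qed

text \<open>
  The algebra homomorphism on the tensor algebra that extends the linear map \<open>f\<close>.
\<close>

definition tensor_lift :: "('k::field, 'v) module \<Rightarrow> ('k, 'b) module \<Rightarrow> ('v \<Rightarrow> 'b) \<Rightarrow> ('k, 'v) tensor \<Rightarrow> 'b"
  where "tensor_lift V B f = (\<lambda>T\<in>carrier (tensor_alg V). the_elem ((\<lambda>p. word_eval B (word_map f p)) ` T))"

lemma the_elem_tensor_class:
  assumes V: "module base_field V" and p: "p \<in> carrier (word_alg V)"
    and G: "\<And>q. \<lbrakk>q \<in> carrier (word_alg V); tensor_class V q = tensor_class V p\<rbrakk> \<Longrightarrow> G q = G p"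
  shows "the_elem (G ` tensor_class V p) = G p"
proof (rule the_elem_image_unique)
  show "tensor_class V p \<noteq> {}" using p mem_tensor_class_iff[OF V p, of p] by blast
  show "G q = G p" if "q \<in> tensor_class V p" for q
    using that G mem_tensor_class_iff[OF V p] by blast
qed

context
  fixes V :: "('k::field, 'v) module" and B :: "('k, 'b) module"
  assumes V: "module base_field V" and B: "assoc_algebra B"
begin

lemma word_lift_cong:
  assumes f: "f \<in> lin_maps V B" and p: "p \<in> carrier (word_alg V)" and q: "q \<in> carrier (word_alg V)"
    and eq: "tensor_class V p = tensor_class V q"
  shows "word_eval B (word_map f p) = word_eval B (word_map f q)"
proof -
  interpret R: ring B by (rule assoc_algebraD[OF B])
  have fB: "f ` carrier V \<subseteq> carrier B" using lin_mapsD[OF f] by auto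
  note E = alg_homsD(1)[OF word_lift_alg_hom[OF B fB]]
  have pq: "p - q \<in> tensor_null V" using eq p q by (simp only: tensor_class_eq_iff[OF V])
  then have "p - q \<in> carrier (word_alg V)"
    using submodule_base_fieldD(1)[OF tensor_null_submodule[OF V]] by blast
  then have "word_eval B (word_map f p) \<ominus>\<^bsub>B\<^esub> word_eval B (word_map f q) = \<zero>\<^bsub>B\<^esub>"
    using lin_maps_minus[OF E module_word_alg assoc_algebraD(2)[OF B] p q] p q
      tensor_null_lift[OF V B f pq] by (simp add: word_alg_minus)
  then show ?thesis using lin_mapsD(1)[OF E p] lin_mapsD(1)[OF E q] p q by simp
qed

lemma tensor_lift_class:
  assumes f: "f \<in> lin_maps V B" and p: "p \<in> carrier (word_alg V)"
  shows "tensor_lift V B f (tensor_class V p) = word_eval B (word_map f p)"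
  unfolding tensor_lift_def
  using p by (simp only: restrict_apply' tensor_alg_simps[OF V] imageI)
    (rule the_elem_tensor_class[OF V p], rule word_lift_cong[OF f])

lemma tensor_lift_alg_hom:
  assumes f: "f \<in> lin_maps V B"
  shows "tensor_lift V B f \<in> alg_homs (tensor_alg V) B"
proof -
  have fB: "f ` carrier V \<subseteq> carrier B" using lin_mapsD[OF f] by auto
  note E = alg_homsD[OF word_lift_alg_hom[OF B fB]]
  note E' = lin_mapsD[OF E(1)]
  have lift: "tensor_lift V B f (tensor_class V p) = (\<lambda>p\<in>carrier (word_alg V). word_eval B (word_map f p)) p"
    if "p \<in> carrier (word_alg V)" for p
    using that tensor_lift_class[OF f that] by (simp del: word_alg_simps)
  interpret W: ring "word_alg V" by (rule ring_word_alg)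
  interpret WL: module base_field "word_alg V" by (rule module_word_alg)
  note ops = word_alg_simps(2-)[symmetric]
  show ?thesis
  proof (intro alg_homsI lin_mapsI)
    fix s t c assume "s \<in> carrier (tensor_alg V)" "t \<in> carrier (tensor_alg V)"
    then obtain p q where pq: "p \<in> carrier (word_alg V)" "q \<in> carrier (word_alg V)"
      and st: "s = tensor_class V p" "t = tensor_class V q"
      by (auto simp only: tensor_alg_simps[OF V])
    have "tensor_lift V B f (tensor_class V (p \<oplus>\<^bsub>word_alg V\<^esub> q)) = tensor_lift V B f s \<oplus>\<^bsub>B\<^esub> tensor_lift V B f t"
      unfolding st using pq by (simp only: lift W.add.m_closed E'(2))
    then show "tensor_lift V B f (s \<oplus>\<^bsub>tensor_alg V\<^esub> t) = tensor_lift V B f s \<oplus>\<^bsub>B\<^esub> tensor_lift V B f t"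
      using pq by (simp add: st tensor_class_add[OF V])
    have "tensor_lift V B f (tensor_class V (p \<otimes>\<^bsub>word_alg V\<^esub> q)) = tensor_lift V B f s \<otimes>\<^bsub>B\<^esub> tensor_lift V B f t"
      unfolding st using pq by (simp only: lift W.m_closed E(3))
    then show "tensor_lift V B f (s \<otimes>\<^bsub>tensor_alg V\<^esub> t) = tensor_lift V B f s \<otimes>\<^bsub>B\<^esub> tensor_lift V B f t"
      using pq by (simp add: st tensor_class_mult[OF V])
  next
    fix s c assume "s \<in> carrier (tensor_alg V)"
    then obtain p where p: "p \<in> carrier (word_alg V)" and s: "s = tensor_class V p"
      by (auto simp only: tensor_alg_simps[OF V])
    show "tensor_lift V B f s \<in> carrier B" using p by (simp only: s lift E'(1))
    have "c \<odot>\<^bsub>word_alg V\<^esub> p \<in> carrier (word_alg V)" using p by (intro WL.smult_closed) simp_all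
    then have "tensor_lift V B f (tensor_class V (c \<odot>\<^bsub>word_alg V\<^esub> p)) = c \<odot>\<^bsub>B\<^esub> tensor_lift V B f s"
      unfolding s using p by (simp only: lift E'(3))
    then show "tensor_lift V B f (c \<odot>\<^bsub>tensor_alg V\<^esub> s) = c \<odot>\<^bsub>B\<^esub> tensor_lift V B f s"
      using p by (simp add: s tensor_class_smult[OF V])
  next
    have "tensor_lift V B f (tensor_class V \<one>\<^bsub>word_alg V\<^esub>) = \<one>\<^bsub>B\<^esub>"
      by (simp only: lift W.one_closed E(4))
    then show "tensor_lift V B f \<one>\<^bsub>tensor_alg V\<^esub> = \<one>\<^bsub>B\<^esub>" by (simp add: tensor_alg_simps[OF V])
  qed (simp add: tensor_lift_def)
qed

text \<open>
  The uniqueness half of the universal property: classes of single letters generate the tensor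
  algebra, so a homomorphism is evaluation of words at its values on these classes.
\<close>

lemma alg_hom_tensor_class:
  assumes g: "g \<in> alg_homs (tensor_alg V) B"
    and f: "\<And>x. x \<in> carrier V \<Longrightarrow> g (tensor_class V (single [x] 1)) = f x"
    and p: "p \<in> carrier (word_alg V)"
  shows "g (tensor_class V p) = word_eval B (word_map f p)"
proof -
  interpret R: ring B by (rule assoc_algebraD[OF B])
  interpret T: ring "tensor_alg V" by (rule assoc_algebraD[OF assoc_algebra_tensor_alg[OF V]])
  note g' = alg_homsD[OF g]
  note g'' = lin_mapsD[OF g'(1)]
  have cl: "tensor_class V q \<in> carrier (tensor_alg V)" if "q \<in> carrier (word_alg V)" for q
    using that by (simp only: tensor_alg_simps[OF V] imageI)
  have fB: "f ` carrier V \<subseteq> carrier B"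
  proof
    fix b assume "b \<in> f ` carrier V"
    then obtain x where x: "x \<in> carrier V" "b = g (tensor_class V (single [x] 1))" using f by auto
    then show "b \<in> carrier B" using g''(1)[OF cl[of "single [x] 1"]] by simp
  qed
  have word: "g (tensor_class V (single w 1)) = foldr (\<otimes>\<^bsub>B\<^esub>) (map f w) \<one>\<^bsub>B\<^esub>"
    if "w \<in> lists (carrier V)" for w
    using that
  proof (induction w)
    case Nil
    then show ?case using g'(4) by (simp add: tensor_alg_simps[OF V] one_poly_mapping_list)
  next
    case (Cons x w)
    have k: "single [x] 1 \<in> carrier (word_alg V)" "single w 1 \<in> carrier (word_alg V)"
      using Cons by auto
    have "tensor_class V (single (x # w) 1) =
        tensor_class V (single [x] 1) \<otimes>\<^bsub>tensor_alg V\<^esub> tensor_class V (single w 1)"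
      using k by (simp only: tensor_class_mult[OF V]) (simp add: single_mult_single)
    then show ?case using Cons g'(3)[OF cl[OF k(1)] cl[OF k(2)]] f by simp
  qed
  have "keys p \<subseteq> lists (carrier V)" using p by simp
  then show ?thesis
  proof (induction p rule: poly_mapping_induct_single)
    case zero
    show ?case
      using lin_maps_zero[OF g'(1)] assoc_algebraD(2)[OF B] assoc_algebraD(2)[OF assoc_algebra_tensor_alg[OF V]]
      by (simp add: tensor_alg_simps[OF V] word_eval_zero[OF B])
  next
    case (add p w a)
    have k: "p \<in> carrier (word_alg V)" "single w 1 \<in> carrier (word_alg V)" "single w a \<in> carrier (word_alg V)"
      using add by auto
    have "tensor_class V (single w a) = a \<odot>\<^bsub>tensor_alg V\<^esub> tensor_class V (single w 1)"
      using k by (simp only: tensor_class_smult[OF V]) (simp add: single_mult_single)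
    moreover have fl: "keys (word_map f p) \<subseteq> lists (carrier B)" "map f w \<in> lists (carrier B)"
      using keys_word_map_lists[OF add(1) fB] add(2) fB by (auto simp: subset_iff)
    ultimately have gw: "g (tensor_class V (single w a)) = word_eval B (single (map f w) a)"
      using g''(3)[OF cl[OF k(2)]] word[OF add(2)] by (simp only: word_eval_single[OF B])
    have "g (tensor_class V (p + single w a)) = g (tensor_class V p) \<oplus>\<^bsub>B\<^esub> g (tensor_class V (single w a))"
      using k g''(2)[OF cl[OF k(1)] cl[OF k(3)]] by (simp only: tensor_class_add[OF V])
    then show ?case
      using add gw fl by (simp add: word_map_add word_map_single word_eval_add[OF B])
  qed
qed

end


section \<open>Functoriality of tensor powers\<close>

definition tensor_gen :: "('k::field, 'v) module \<Rightarrow> 'v \<Rightarrow> ('k, 'v) tensor"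
  where "tensor_gen V = (\<lambda>x\<in>carrier V. tensor_class V (single [x] 1))"

text \<open>
  Uniqueness, applied to the identity of the tensor algebra.
\<close>

lemma word_eval_tensor_gen:
  assumes V: "module base_field V" and p: "p \<in> carrier (word_alg V)"
  shows "word_eval (tensor_alg V) (word_map (tensor_gen V) p) = tensor_class V p"
proof -
  note T = assoc_algebra_tensor_alg[OF V]
  interpret T: ring "tensor_alg V" by (rule assoc_algebraD[OF T])
  let ?id = "\<lambda>t\<in>carrier (tensor_alg V). t"
  have id: "?id \<in> alg_homs (tensor_alg V) (tensor_alg V)"
    by (intro alg_homsI lin_maps_id assoc_algebraD[OF T]) auto
  have cl: "tensor_class V q \<in> carrier (tensor_alg V)" if "q \<in> carrier (word_alg V)" for q
    using that by (simp only: tensor_alg_simps[OF V] imageI)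
  have "?id (tensor_class V p) = word_eval (tensor_alg V) (word_map (tensor_gen V) p)"
  proof (rule alg_hom_tensor_class[OF V T id _ p])
    fix x assume "x \<in> carrier V"
    then show "?id (tensor_class V (single [x] 1)) = tensor_gen V x"
      using cl[of "single [x] 1"] by (simp add: tensor_gen_def)
  qed
  then show ?thesis using cl[OF p] by (simp only: restrict_apply' split: if_split)
qed

text \<open>
  The homomorphism between full tensor algebras induced by \<open>l\<close>. Its restrictions to the homogeneous
  components are the tensor powers of \<open>l\<close>, which therefore inherit linearity and functoriality.
\<close>

definition tensor_map ::
  "('k::field, 'v) module \<Rightarrow> ('k, 'w) module \<Rightarrow> ('v \<Rightarrow> 'w) \<Rightarrow> ('k, 'v) tensor \<Rightarrow> ('k, 'w) tensor"
  where "tensor_map V W l = tensor_lift V (tensor_alg W) (compose (carrier V) (tensor_gen W) l)"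

context
  fixes V :: "('k::field, 'v) module" and W :: "('k, 'w) module" and l :: "'v \<Rightarrow> 'w"
  assumes V: "module base_field V" and W: "module base_field W" and l: "l \<in> lin_maps V W"
begin

lemma tensor_gen_compose: "compose (carrier V) (tensor_gen W) l \<in> lin_maps V (tensor_alg W)"
  using lin_maps_compose[OF W l tensor_gen_lin_map[OF W] V] by (simp add: tensor_gen_def)

lemma tensor_map_alg_hom: "tensor_map V W l \<in> alg_homs (tensor_alg V) (tensor_alg W)"
  unfolding tensor_map_def
  by (rule tensor_lift_alg_hom[OF V assoc_algebra_tensor_alg[OF W] tensor_gen_compose])

lemma word_map_word_alg:
  "p \<in> carrier (word_alg V) \<Longrightarrow> word_map l p \<in> carrier (word_alg W)"
  using keys_word_map_lists[of p "carrier V" l "carrier W"] lin_mapsD(1)[OF l] by auto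

lemma tensor_map_class:
  assumes p: "p \<in> carrier (word_alg V)"
  shows "tensor_map V W l (tensor_class V p) = tensor_class W (word_map l p)"
proof -
  have "tensor_map V W l (tensor_class V p) =
      word_eval (tensor_alg W) (word_map (compose (carrier V) (tensor_gen W) l) p)"
    unfolding tensor_map_def
    by (rule tensor_lift_class[OF V assoc_algebra_tensor_alg[OF W] tensor_gen_compose p])
  also have "word_map (compose (carrier V) (tensor_gen W) l) p = word_map (tensor_gen W) (word_map l p)"
    using p by (subst word_map_comp, intro word_map_cong[of _ "carrier V"]) (simp_all add: compose_eq)
  also have "word_eval (tensor_alg W) \<dots> = tensor_class W (word_map l p)"
    by (rule word_eval_tensor_gen[OF W word_map_word_alg[OF p]])
  finally show ?thesis .
qed

end

lemma words_word_alg: "keys p \<subseteq> words V n \<Longrightarrow> p \<in> carrier (word_alg V)"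
  using subset_trans[of "keys p" "words V n" "lists (carrier V)"] by (simp add: words_def subset_iff)

lemma tensor_powerE:
  assumes "t \<in> carrier (tensor_power V n)"
  obtains p where "keys p \<subseteq> words V n" "p \<in> carrier (word_alg V)" "t = tensor_class V p"
proof -
  obtain p where "keys p \<subseteq> words V n" "t = tensor_class V p"
    using assms by (auto simp: tensor_power_def)
  moreover from this(1) have "p \<in> carrier (word_alg V)" by (rule words_word_alg)
  ultimately show thesis by (intro that)
qed

lemma tensor_class_in_power: "keys p \<subseteq> words V n \<Longrightarrow> tensor_class V p \<in> carrier (tensor_power V n)"
  by (auto simp: tensor_power_def)

lemma tensor_power_subset:
  assumes V: "module base_field V"
  shows "carrier (tensor_power V n) \<subseteq> carrier (tensor_alg V)"
  by (auto elim!: tensor_powerE simp: tensor_alg_simps[OF V])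

lemma tensor_power_simps [simp]:
  "(\<oplus>\<^bsub>tensor_power V n\<^esub>) = (\<oplus>\<^bsub>tensor_alg V\<^esub>)" "(\<odot>\<^bsub>tensor_power V n\<^esub>) = (\<odot>\<^bsub>tensor_alg V\<^esub>)"
  "\<zero>\<^bsub>tensor_power V n\<^esub> = \<zero>\<^bsub>tensor_alg V\<^esub>"
  by (simp_all add: tensor_power_def)

lemma tensor_power_submodule:
  assumes V: "module base_field V"
  shows "submodule (carrier (tensor_power V n)) base_field (tensor_alg V)"
proof (rule submodule_base_fieldI)
  show "module base_field (tensor_alg V)" by (rule assoc_algebraD[OF assoc_algebra_tensor_alg[OF V]])
  show "carrier (tensor_power V n) \<subseteq> carrier (tensor_alg V)" by (rule tensor_power_subset[OF V])
  show "\<zero>\<^bsub>tensor_alg V\<^esub> \<in> carrier (tensor_power V n)"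
    using tensor_class_in_power[of 0 V n] by (simp add: tensor_alg_simps[OF V])
  fix s t c assume "s \<in> carrier (tensor_power V n)"
  then obtain p where p: "keys p \<subseteq> words V n" "p \<in> carrier (word_alg V)" "s = tensor_class V p"
    by (rule tensor_powerE)
  show "c \<odot>\<^bsub>tensor_alg V\<^esub> s \<in> carrier (tensor_power V n)"
    using p by (simp only: tensor_class_smult[OF V] tensor_class_in_power keys_scale_subset)
  assume "t \<in> carrier (tensor_power V n)"
  then obtain q where q: "keys q \<subseteq> words V n" "q \<in> carrier (word_alg V)" "t = tensor_class V q"
    by (rule tensor_powerE)
  show "s \<oplus>\<^bsub>tensor_alg V\<^esub> t \<in> carrier (tensor_power V n)"
    using p q by (simp only: tensor_class_add[OF V] tensor_class_in_power keys_add_subset)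
qed

lemma module_tensor_power: "module base_field V \<Longrightarrow> module base_field (tensor_power V n)"
  using submodule.submodule_is_module[OF tensor_power_submodule[of V n]
      assoc_algebraD(2)[OF assoc_algebra_tensor_alg[of V]]]
  by (simp add: tensor_power_def)

context
  fixes V :: "('k::field, 'v) module" and W :: "('k, 'w) module" and l :: "'v \<Rightarrow> 'w"
  assumes V: "module base_field V" and W: "module base_field W" and l: "l \<in> lin_maps V W"
begin

lemma tensor_power_map_eq:
  assumes t: "t \<in> carrier (tensor_power V n)"
  shows "tensor_power_map V W l n t = tensor_map V W l t"
proof -
  obtain p where p: "keys p \<subseteq> words V n" "p \<in> carrier (word_alg V)" "t = tensor_class V p"
    using t by (rule tensor_powerE)
  have "the_elem ((\<lambda>p. tensor_class W (word_map l p)) ` tensor_class V p) = tensor_class W (word_map l p)"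
    by (rule the_elem_tensor_class[OF V p(2)]) (metis tensor_map_class[OF V W l] p(2))
  then show ?thesis
    using t p by (simp only: tensor_power_map_def restrict_apply' tensor_map_class[OF V W l])
qed

lemma tensor_power_map_class:
  "keys p \<subseteq> words V n \<Longrightarrow> tensor_power_map V W l n (tensor_class V p) = tensor_class W (word_map l p)"
  by (simp only: tensor_power_map_eq[OF tensor_class_in_power] tensor_map_class[OF V W l] words_word_alg)

lemma tensor_power_map_lin: "tensor_power_map V W l n \<in> lin_maps (tensor_power V n) (tensor_power W n)"
proof (rule lin_mapsI)
  note T = lin_mapsD[OF alg_homsD(1)[OF tensor_map_alg_hom[OF V W l]]]
  note sub = subsetD[OF tensor_power_subset[OF V]]
  interpret P: module base_field "tensor_power V n" by (rule module_tensor_power[OF V])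
  fix s t c assume s: "s \<in> carrier (tensor_power V n)"
  obtain p where p: "keys p \<subseteq> words V n" "s = tensor_class V p" using s by (rule tensor_powerE)
  have "l ` carrier V \<subseteq> carrier W" using lin_mapsD(1)[OF l] by auto
  then show "tensor_power_map V W l n s \<in> carrier (tensor_power W n)"
    using p keys_word_map_words[OF p(1), of l W]
    by (simp only: tensor_power_map_class tensor_class_in_power)
  show "tensor_power_map V W l n (c \<odot>\<^bsub>tensor_power V n\<^esub> s) = c \<odot>\<^bsub>tensor_power W n\<^esub> tensor_power_map V W l n s"
    using s P.smult_closed[of c s] T(3)[OF sub] by (simp add: tensor_power_map_eq)
  assume t: "t \<in> carrier (tensor_power V n)"
  show "tensor_power_map V W l n (s \<oplus>\<^bsub>tensor_power V n\<^esub> t) =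
      tensor_power_map V W l n s \<oplus>\<^bsub>tensor_power W n\<^esub> tensor_power_map V W l n t"
    using s t P.add.m_closed[of s t] T(2)[OF sub sub] by (simp add: tensor_power_map_eq)
qed (simp add: tensor_power_map_def)

end

lemma tensor_map_compose:
  assumes U: "module base_field U" and V: "module base_field V" and W: "module base_field W"
    and l: "l \<in> lin_maps U V" and m: "m \<in> lin_maps V W" and t: "t \<in> carrier (tensor_alg U)"
  shows "tensor_map V W m (tensor_map U V l t) = tensor_map U W (compose (carrier U) m l) t"
proof -
  obtain p where p: "p \<in> carrier (word_alg U)" "t = tensor_class U p"
    using t by (auto simp only: tensor_alg_simps[OF U])
  have "word_map m (word_map l p) = word_map (compose (carrier U) m l) p"
    using p(1) by (subst word_map_comp, intro word_map_cong[of _ "carrier U"]) (simp_all add: compose_eq)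
  then show ?thesis
    using p word_map_word_alg[OF U V l p(1)] lin_maps_compose[OF V l m U]
    by (simp only: tensor_map_class U V W l m)
qed

lemma tensor_map_id:
  assumes V: "module base_field V" and t: "t \<in> carrier (tensor_alg V)"
  shows "tensor_map V V (\<lambda>x\<in>carrier V. x) t = t"
proof -
  obtain p where p: "p \<in> carrier (word_alg V)" "t = tensor_class V p"
    using t by (auto simp only: tensor_alg_simps[OF V])
  have "word_map (\<lambda>x\<in>carrier V. x) p = word_map (\<lambda>x. x) p"
    using p(1) by (intro word_map_cong[of _ "carrier V"]) auto
  then show ?thesis
    using p by (simp only: tensor_map_class[OF V V lin_maps_id[OF V]] word_map_id)
qed

lemma tensor_power_map_closed:
  assumes "module base_field V" "module base_field W" "l \<in> lin_maps V W" "t \<in> carrier (tensor_power V n)"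
  shows "tensor_power_map V W l n t \<in> carrier (tensor_power W n)"
  using lin_mapsD(1)[OF tensor_power_map_lin[OF assms(1-3)] assms(4)] .

lemma tensor_power_map_compose:
  assumes U: "module base_field U" and V: "module base_field V" and W: "module base_field W"
    and l: "l \<in> lin_maps U V" and m: "m \<in> lin_maps V W" and t: "t \<in> carrier (tensor_power U n)"
  shows "tensor_power_map V W m n (tensor_power_map U V l n t) =
    tensor_power_map U W (compose (carrier U) m l) n t"
proof -
  have "tensor_map U V l t \<in> carrier (tensor_power V n)"
    using tensor_power_map_closed[OF U V l t] by (simp only: tensor_power_map_eq[OF U V l t])
  then show ?thesis
    using t tensor_map_compose[OF U V W l m subsetD[OF tensor_power_subset[OF U] t]]
    by (simp only: tensor_power_map_eq[OF U V l] tensor_power_map_eq[OF V W m]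
        tensor_power_map_eq[OF U W lin_maps_compose[OF V l m U]])
qed

lemma tensor_power_map_id:
  assumes V: "module base_field V" and t: "t \<in> carrier (tensor_power V n)"
  shows "tensor_power_map V V (\<lambda>x\<in>carrier V. x) n t = t"
  using tensor_map_id[OF V subsetD[OF tensor_power_subset[OF V] t]]
  by (simp only: tensor_power_map_eq[OF V V lin_maps_id[OF V] t])


section \<open>The canonical map of a generating subspace\<close>

abbreviation subspace_of :: "('k::field, 'a) module \<Rightarrow> 'a set \<Rightarrow> ('k, 'a) module"
  where "subspace_of A A1 \<equiv> A\<lparr>carrier := A1\<rparr>"

context
  fixes A :: "('k::field, 'a) module" and A1 :: "'a set"
  assumes A: "assoc_algebra A" and A1: "submodule A1 base_field A"
begin

lemma module_subspace: "module base_field (subspace_of A A1)"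
  by (rule submodule.submodule_is_module[OF A1 assoc_algebraD(2)[OF A]])

lemma subspace_subset: "A1 \<subseteq> carrier A"
  using submodule_base_fieldD(1)[OF A1] .

lemma inclusion_lin: "(\<lambda>x\<in>A1. x) \<in> lin_maps (subspace_of A A1) A"
  using submodule_base_fieldD[OF A1] by (intro lin_mapsI) auto

lemma tensor_lift_inclusion_class:
  assumes p: "p \<in> carrier (word_alg (subspace_of A A1))"
  shows "tensor_lift (subspace_of A A1) A (\<lambda>x\<in>A1. x) (tensor_class (subspace_of A A1) p) = word_eval A p"
proof -
  have "word_map (\<lambda>x\<in>A1. x) p = word_map (\<lambda>x. x) p"
    using p by (intro word_map_cong[of _ A1]) auto
  then show ?thesis
    using tensor_lift_class[OF module_subspace A inclusion_lin p] by (simp add: word_map_id)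
qed

lemma canonical_map_eq:
  assumes t: "t \<in> carrier (tensor_alg (subspace_of A A1))"
  shows "canonical_map A t = tensor_lift (subspace_of A A1) A (\<lambda>x\<in>A1. x) t"
proof -
  obtain p where p: "p \<in> carrier (word_alg (subspace_of A A1))" "t = tensor_class (subspace_of A A1) p"
    using t by (auto simp only: tensor_alg_simps[OF module_subspace])
  have "the_elem (word_eval A ` t) = word_eval A p"
    unfolding p(2) by (rule the_elem_tensor_class[OF module_subspace p(1)])
      (metis tensor_lift_inclusion_class p(1))
  then show ?thesis using p by (simp only: canonical_map_def tensor_lift_inclusion_class)
qed

lemma relation_ideal_eq:
  "relation_ideal A A1 = {t \<in> carrier (tensor_alg (subspace_of A A1)).
    tensor_lift (subspace_of A A1) A (\<lambda>x\<in>A1. x) t = \<zero>\<^bsub>A\<^esub>}"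
  unfolding relation_ideal_def a_kernel_def' using canonical_map_eq by auto

lemma canonical_hom:
  "tensor_lift (subspace_of A A1) A (\<lambda>x\<in>A1. x) \<in> alg_homs (tensor_alg (subspace_of A A1)) A"
  by (rule tensor_lift_alg_hom[OF module_subspace A inclusion_lin])

lemma canonical_gen:
  assumes "x \<in> A1"
  shows "tensor_lift (subspace_of A A1) A (\<lambda>x\<in>A1. x) (tensor_class (subspace_of A A1) (single [x] 1)) = x"
  using assms subspace_subset tensor_lift_inclusion_class[of "single [x] 1"]
  by (auto simp: word_eval_generator[OF A])

text \<open>
  The image of the canonical map is a subalgebra that contains \<open>A1\<close> and is contained in every
  such subalgebra, so it is the subalgebra generated by \<open>A1\<close>.
\<close>

lemma alg_generated_iff:
  "alg_generated A A1 = carrier A \<longleftrightarrow>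
    tensor_lift (subspace_of A A1) A (\<lambda>x\<in>A1. x) ` carrier (tensor_alg (subspace_of A A1)) = carrier A"
proof -
  let ?T = "tensor_alg (subspace_of A A1)" and ?h = "tensor_lift (subspace_of A A1) A (\<lambda>x\<in>A1. x)"
  interpret R: ring A by (rule assoc_algebraD[OF A])
  interpret L: module base_field A by (rule assoc_algebraD[OF A])
  note T = assoc_algebra_tensor_alg[OF module_subspace]
  interpret T: ring ?T by (rule assoc_algebraD[OF T])
  interpret H: ring_hom_ring ?T A ?h
    using assoc_algebraD[OF T] assoc_algebraD[OF A] alg_homsD[OF canonical_hom] by (intro ring_hom_ringI2)
  have image: "?h ` carrier ?T = word_eval A ` carrier (word_alg (subspace_of A A1))"
    unfolding tensor_alg_simps[OF module_subspace] image_image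
    by (intro image_cong refl tensor_lift_inclusion_class)
  have "alg_generated A A1 = ?h ` carrier ?T"
  proof
    have "subring (?h ` carrier ?T) A" using H.img_is_subring[OF T.carrier_is_subring] .
    moreover have "submodule (?h ` carrier ?T) base_field A"
      by (rule submodule_image[OF alg_homsD(1)[OF canonical_hom] assoc_algebraD(2)[OF T] assoc_algebraD(2)[OF A]])
    moreover have "A1 \<subseteq> ?h ` carrier ?T"
    proof
      fix x assume x: "x \<in> A1"
      have "tensor_class (subspace_of A A1) (single [x] 1) \<in> carrier ?T"
        using x by (simp add: tensor_alg_simps[OF module_subspace])
      then show "x \<in> ?h ` carrier ?T" using canonical_gen[OF x] by (metis imageI)
    qed
    ultimately show "alg_generated A A1 \<subseteq> ?h ` carrier ?T" by (auto simp: alg_generated_def)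
    show "?h ` carrier ?T \<subseteq> alg_generated A A1"
      unfolding image alg_generated_def using word_eval_in_subalgebra[OF A] by auto
  qed
  then show ?thesis by simp
qed

end


section \<open>The two categories\<close>

lemma intertwines_iff:
  "intertwines V R W S l \<longleftrightarrow> (\<forall>t\<in>carrier (tensor_power V 2).
    tensor_power_map V W l 2 (R t) = S (tensor_power_map V W l 2 t))"
  by (auto simp: intertwines_def compose_def restrict_def fun_eq_iff)

lemma Vect2_simps:
  "(V, R) \<in> Obj Vect2 \<longleftrightarrow> fin_dim V \<and> R \<in> tensor2_endos V"
  "l \<in> Hom Vect2 (V, R) (W, S) \<longleftrightarrow> l \<in> lin_maps V W \<and> intertwines V R W S l"
  "Ident Vect2 (V, R) = (\<lambda>x\<in>carrier V. x)"
  "Comp Vect2 (V, R) y z m l = compose (carrier V) m l"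
  by (simp_all add: Vect2_def)

lemma fin_dim_module: "fin_dim V \<Longrightarrow> module base_field V"
  by (simp add: fin_dim_def)

lemma tensor2_endos_closed:
  "R \<in> tensor2_endos V \<Longrightarrow> t \<in> carrier (tensor_power V 2) \<Longrightarrow> R t \<in> carrier (tensor_power V 2)"
  unfolding tensor2_endos_def by (rule lin_mapsD(1))

lemma intertwines_id:
  assumes V: "module base_field V" and R: "R \<in> tensor2_endos V"
  shows "intertwines V R V R (\<lambda>x\<in>carrier V. x)"
  unfolding intertwines_iff using tensor2_endos_closed[OF R] by (simp add: tensor_power_map_id[OF V])

lemma intertwines_compose:
  assumes U: "module base_field U" and V: "module base_field V" and W: "module base_field W"
    and l: "l \<in> lin_maps U V" and m: "m \<in> lin_maps V W" and Q: "Q \<in> tensor2_endos U"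
    and Ql: "intertwines U Q V R l" and Rm: "intertwines V R W S m"
  shows "intertwines U Q W S (compose (carrier U) m l)"
  unfolding intertwines_iff
proof
  fix t assume t: "t \<in> carrier (tensor_power U 2)"
  note c = tensor_power_map_compose[OF U V W l m, of _ 2]
  have lt: "tensor_power_map U V l 2 t \<in> carrier (tensor_power V 2)"
    using t by (rule tensor_power_map_closed[OF U V l])
  have "tensor_power_map U W (compose (carrier U) m l) 2 (Q t) =
      tensor_power_map V W m 2 (tensor_power_map U V l 2 (Q t))"
    using c[OF tensor2_endos_closed[OF Q t]] by simp
  also have "\<dots> = S (tensor_power_map V W m 2 (tensor_power_map U V l 2 t))"
    using Ql Rm t lt by (simp add: intertwines_iff)
  finally show "tensor_power_map U W (compose (carrier U) m l) 2 (Q t) =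
      S (tensor_power_map U W (compose (carrier U) m l) 2 t)"
    using c[OF t] by simp
qed

lemma category_Vect2: "category (Vect2 :: (('k::field, 'v) vect2, 'v \<Rightarrow> 'v) cat)"
proof
  fix w x y z :: "('k, 'v) vect2" and f g h :: "'v \<Rightarrow> 'v"
  assume x: "x \<in> Obj Vect2"
  obtain V R where xV: "x = (V, R)" by fastforce
  show "Ident Vect2 x \<in> Hom Vect2 x x"
    using x unfolding xV by (simp add: Vect2_simps fin_dim_module lin_maps_id intertwines_id)
  assume y: "y \<in> Obj Vect2"
  obtain V' R' where yV: "y = (V', R')" by fastforce
  {
    assume f: "f \<in> Hom Vect2 x y"
    note f' = lin_mapsD[of f V V']
    have "f \<in> carrier V \<rightarrow> carrier V'" "f \<in> extensional (carrier V)"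
      using f f' unfolding xV yV by (auto simp: Vect2_simps)
    then show "Comp Vect2 x x y f (Ident Vect2 x) = f" "Comp Vect2 x y y (Ident Vect2 y) f = f"
      unfolding xV yV Vect2_simps by (simp_all add: compose_Id Id_compose)
  }
  assume z: "z \<in> Obj Vect2"
  obtain V'' R'' where zV: "z = (V'', R'')" by fastforce
  {
    assume f: "f \<in> Hom Vect2 x y" and g: "g \<in> Hom Vect2 y z"
    show "Comp Vect2 x y z g f \<in> Hom Vect2 x z"
      using x y z f g unfolding xV yV zV Vect2_simps
      by (meson fin_dim_module intertwines_compose lin_maps_compose)
  }
  assume w: "w \<in> Obj Vect2"
  obtain U Q where wV: "w = (U, Q)" by fastforce
  assume f: "f \<in> Hom Vect2 w x" and g: "g \<in> Hom Vect2 x y" and h: "h \<in> Hom Vect2 y z"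
  have "f \<in> carrier U \<rightarrow> carrier V"
    using f lin_mapsD[of f U V] unfolding wV xV by (auto simp: Vect2_simps)
  then show "Comp Vect2 w y z h (Comp Vect2 w x y g f) = Comp Vect2 w x z (Comp Vect2 x y z h g) f"
    unfolding wV xV yV zV Vect2_simps by (rule compose_assoc)
qed

lemma EQA_simps:
  "((A1, A), R) \<in> Obj EQA \<longleftrightarrow> (A1, A) \<in> QA_Obj \<and> R \<in> tensor2_endos (subspace_of A A1) \<and>
    relation_ideal A A1 = Idl\<^bsub>tensor_alg (subspace_of A A1)\<^esub> (R ` carrier (tensor_power (subspace_of A A1) 2))"
  "Ident EQA ((A1, A), R) = (\<lambda>x\<in>carrier A. x)"
  "Comp EQA ((A1, A), R) y z \<beta> \<alpha> = compose (carrier A) \<beta> \<alpha>"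
  by (simp_all add: EQA_def)

lemma EQA_ObjD:
  assumes "((A1, A), R) \<in> Obj EQA"
  shows "assoc_algebra A" "submodule A1 base_field A" "fin_dim (subspace_of A A1)"
    "alg_generated A A1 = carrier A" "R \<in> tensor2_endos (subspace_of A A1)"
    "relation_ideal A A1 = Idl\<^bsub>tensor_alg (subspace_of A A1)\<^esub> (R ` carrier (tensor_power (subspace_of A A1) 2))"
    "(subspace_of A A1, R) \<in> Obj Vect2" "A1 \<subseteq> carrier A"
  using assms subspace_subset[of A A1] by (auto simp: EQA_simps QA_Obj_def Vect2_simps)

text \<open>
  The compatibility of an arrow with the operators only involves its restriction to the generators,
  and it is exactly the condition for this restriction to be an arrow of \<open>Vect2\<close>. So the category
  laws for \<open>EQA\<close> reduce to those for \<open>Vect2\<close>.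
\<close>

lemma EQA_Hom_iff:
  assumes A: "submodule A1 base_field A"
  shows "\<alpha> \<in> Hom EQA ((A1, A), R) ((B1, B), S) \<longleftrightarrow> \<alpha> \<in> alg_homs A B \<and> \<alpha> ` A1 \<subseteq> B1 \<and>
    restrict \<alpha> A1 \<in> Hom Vect2 (subspace_of A A1, R) (subspace_of B B1, S)"
proof -
  have "restrict \<alpha> A1 \<in> lin_maps (subspace_of A A1) (subspace_of B B1)"
    if \<alpha>: "\<alpha> \<in> alg_homs A B" "\<alpha> ` A1 \<subseteq> B1"
    using submodule_base_fieldD[OF A] lin_mapsD[OF alg_homsD(1)[OF \<alpha>(1)]] \<alpha>(2)
    by (intro lin_mapsI) (auto simp: subset_iff)
  then show ?thesis
    by (auto simp: EQA_def QA_Hom_def Vect2_simps)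
qed

lemma restrict_compose:
  assumes "A1 \<subseteq> A" "\<alpha> ` A1 \<subseteq> B1"
  shows "restrict (compose A \<beta> \<alpha>) A1 = compose A1 (restrict \<beta> B1) (restrict \<alpha> A1)"
  using assms by (auto simp: compose_def restrict_def fun_eq_iff)

definition generators_obj :: "('k::field, 'a) eqa \<Rightarrow> ('k, 'a) vect2"
  where "generators_obj = (\<lambda>((A1, A), R). (subspace_of A A1, R))"

definition generators_map :: "('k::field, 'a) eqa \<Rightarrow> ('k, 'a) eqa \<Rightarrow> ('a \<Rightarrow> 'a) \<Rightarrow> 'a \<Rightarrow> 'a"
  where "generators_map = (\<lambda>((A1, A), R) y \<alpha>. restrict \<alpha> A1)"

lemma EQA_Ident_restrict:
  "A1 \<subseteq> carrier A \<Longrightarrow> restrict (Ident EQA ((A1, A), R)) A1 = Ident Vect2 (subspace_of A A1, R)"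
  by (auto simp: EQA_simps Vect2_simps restrict_def fun_eq_iff)

lemma EQA_Comp_Hom:
  assumes x: "((A1, A), R) \<in> Obj EQA" and y: "((B1, B), S) \<in> Obj EQA" and z: "((C1, C), T) \<in> Obj EQA"
    and \<alpha>: "\<alpha> \<in> Hom EQA ((A1, A), R) ((B1, B), S)" and \<beta>: "\<beta> \<in> Hom EQA ((B1, B), S) ((C1, C), T)"
  shows "compose (carrier A) \<beta> \<alpha> \<in> Hom EQA ((A1, A), R) ((C1, C), T)"
proof -
  note x' = EQA_ObjD[OF x] and y' = EQA_ObjD[OF y] and z' = EQA_ObjD[OF z]
  note \<alpha>' = \<alpha>[unfolded EQA_Hom_iff[OF x'(2)]] and \<beta>' = \<beta>[unfolded EQA_Hom_iff[OF y'(2)]]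
  have "restrict (compose (carrier A) \<beta> \<alpha>) A1 = Comp Vect2 (subspace_of A A1, R) (subspace_of B B1, S)
      (subspace_of C C1, T) (restrict \<beta> B1) (restrict \<alpha> A1)"
    using \<alpha>' x'(8) by (simp add: restrict_compose Vect2_simps)
  then have "restrict (compose (carrier A) \<beta> \<alpha>) A1 \<in> Hom Vect2 (subspace_of A A1, R) (subspace_of C C1, T)"
    using category.Comp_Hom[OF category_Vect2 x'(7) y'(7) z'(7)] \<alpha>' \<beta>' by simp
  moreover have "compose (carrier A) \<beta> \<alpha> ` A1 \<subseteq> C1"
    using \<alpha>' \<beta>' x'(8) by (auto simp: compose_def)
  ultimately show ?thesis
    using alg_homs_compose[OF x'(1) y'(1), of \<alpha> \<beta> C] \<alpha>' \<beta>' by (simp add: EQA_Hom_iff[OF x'(2)])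
qed

lemma category_EQA: "category (EQA :: (('k::field, 'a) eqa, 'a \<Rightarrow> 'a) cat)"
proof
  fix w x y z :: "('k, 'a) eqa" and f g h :: "'a \<Rightarrow> 'a"
  assume x: "x \<in> Obj EQA"
  obtain A1 A R where xA: "x = ((A1, A), R)" by (metis prod.exhaust)
  note x' = EQA_ObjD[OF x[unfolded xA]]
  show "Ident EQA x \<in> Hom EQA x x"
    unfolding xA EQA_Hom_iff[OF x'(2)]
  proof (intro conjI)
    interpret ring A by (rule assoc_algebraD[OF x'(1)])
    show "Ident EQA ((A1, A), R) \<in> alg_homs A A"
      unfolding EQA_simps by (intro alg_homsI lin_maps_id assoc_algebraD[OF x'(1)]) auto
    show "Ident EQA ((A1, A), R) ` A1 \<subseteq> A1" using x'(8) by (auto simp: EQA_simps)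
    show "restrict (Ident EQA ((A1, A), R)) A1 \<in> Hom Vect2 (subspace_of A A1, R) (subspace_of A A1, R)"
      using category.Ident_Hom[OF category_Vect2 x'(7)] by (simp add: EQA_Ident_restrict[OF x'(8)])
  qed
  assume y: "y \<in> Obj EQA"
  obtain B1 B S where yB: "y = ((B1, B), S)" by (metis prod.exhaust)
  note y' = EQA_ObjD[OF y[unfolded yB]]
  {
    assume f: "f \<in> Hom EQA x y"
    then have "f \<in> alg_homs A B" unfolding xA yB by (simp add: EQA_Hom_iff[OF x'(2)])
    then have "f \<in> carrier A \<rightarrow> carrier B" "f \<in> extensional (carrier A)"
      using lin_mapsD[OF alg_homsD(1)] by auto
    then show "Comp EQA x x y f (Ident EQA x) = f" "Comp EQA x y y (Ident EQA y) f = f"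
      unfolding xA yB EQA_simps by (simp_all add: compose_Id Id_compose)
  }
  assume z: "z \<in> Obj EQA"
  obtain C1 C T where zC: "z = ((C1, C), T)" by (metis prod.exhaust)
  {
    assume f: "f \<in> Hom EQA x y" and g: "g \<in> Hom EQA y z"
    show "Comp EQA x y z g f \<in> Hom EQA x z"
      using EQA_Comp_Hom x y z f g unfolding xA yB zC EQA_simps(3) by blast
  }
  assume w: "w \<in> Obj EQA"
  obtain D1 D Q where wD: "w = ((D1, D), Q)" by (metis prod.exhaust)
  note w' = EQA_ObjD[OF w[unfolded wD]]
  assume f: "f \<in> Hom EQA w x" and g: "g \<in> Hom EQA x y" and h: "h \<in> Hom EQA y z"
  have "f \<in> alg_homs D A" using f unfolding wD xA by (simp add: EQA_Hom_iff[OF w'(2)])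
  then have "f \<in> carrier D \<rightarrow> carrier A" using lin_mapsD(1)[OF alg_homsD(1)] by auto
  then show "Comp EQA w y z h (Comp EQA w x y g f) = Comp EQA w x z (Comp EQA x y z h g) f"
    unfolding wD xA yB zC EQA_simps(3) by (rule compose_assoc)
qed

lemma generators_functor:
  "is_functor (EQA :: (('k::field, 'a) eqa, 'a \<Rightarrow> 'a) cat) Vect2 generators_obj generators_map"
  unfolding is_functor_def
proof (intro conjI ballI)
  fix x y z :: "('k, 'a) eqa" and f g
  assume x: "x \<in> Obj EQA"
  obtain A1 A R where xA: "x = ((A1, A), R)" by (metis prod.exhaust)
  note x' = EQA_ObjD[OF x[unfolded xA]]
  show "generators_obj x \<in> Obj Vect2" using x' by (simp add: xA generators_obj_def)
  show "generators_map x x (Ident EQA x) = Ident Vect2 (generators_obj x)"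
    using EQA_Ident_restrict[OF x'(8)] by (simp add: xA generators_obj_def generators_map_def)
  obtain B1 B S where yB: "y = ((B1, B), S)" by (metis prod.exhaust)
  assume f: "f \<in> Hom EQA x y"
  then have f': "f ` A1 \<subseteq> B1" "restrict f A1 \<in> Hom Vect2 (subspace_of A A1, R) (subspace_of B B1, S)"
    unfolding xA yB by (simp_all add: EQA_Hom_iff[OF x'(2)])
  show "generators_map x y f \<in> Hom Vect2 (generators_obj x) (generators_obj y)"
    using f' by (simp add: xA yB generators_obj_def generators_map_def)
  show "generators_map x z (Comp EQA x y z g f) = Comp Vect2 (generators_obj x) (generators_obj y)
      (generators_obj z) (generators_map y z g) (generators_map x y f)"
    using restrict_compose[OF x'(8) f'(1)]
    by (simp add: xA yB generators_obj_def generators_map_def EQA_simps Vect2_simps)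
qed


section \<open>Algebra homomorphisms and their restrictions to generators\<close>

text \<open>
  Composed with the canonical epimorphism from the tensor algebra, an arrow is determined by its
  values on \<open>A1\<close>.
\<close>

lemma generators_faithful:
  assumes x: "((A1, A), R) \<in> Obj EQA" and y: "((B1, B), S) \<in> Obj EQA"
    and \<alpha>: "\<alpha> \<in> Hom EQA ((A1, A), R) ((B1, B), S)" and \<beta>: "\<beta> \<in> Hom EQA ((A1, A), R) ((B1, B), S)"
    and eq: "restrict \<alpha> A1 = restrict \<beta> A1"
  shows "\<alpha> = \<beta>"
proof -
  note x' = EQA_ObjD[OF x] and y' = EQA_ObjD[OF y]
  let ?V = "subspace_of A A1"
  let ?can = "tensor_lift ?V A (\<lambda>x\<in>A1. x)"
  note V = module_subspace[OF x'(1,2)]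
  note T = assoc_algebra_tensor_alg[OF V]
  note can = canonical_hom[OF x'(1,2)]
  have surj: "?can ` carrier (tensor_alg ?V) = carrier A"
    using x'(4) alg_generated_iff[OF x'(1,2)] by simp
  have on_words: "\<gamma> (?can (tensor_class ?V p)) = word_eval B (word_map \<gamma> p)"
    if \<gamma>: "\<gamma> \<in> alg_homs A B" and p: "p \<in> carrier (word_alg ?V)" for \<gamma> p
  proof -
    have cl: "tensor_class ?V q \<in> carrier (tensor_alg ?V)" if "q \<in> carrier (word_alg ?V)" for q
      using that by (simp only: tensor_alg_simps[OF V] imageI)
    have "compose (carrier (tensor_alg ?V)) \<gamma> ?can (tensor_class ?V p) = word_eval B (word_map \<gamma> p)"
    proof (rule alg_hom_tensor_class[OF V y'(1) alg_homs_compose[OF T x'(1) can \<gamma>] _ p])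
      fix x assume "x \<in> carrier ?V"
      then show "compose (carrier (tensor_alg ?V)) \<gamma> ?can (tensor_class ?V (single [x] 1)) = \<gamma> x"
        using cl[of "single [x] 1"] canonical_gen[OF x'(1,2)] by (simp add: compose_eq)
    qed
    then show ?thesis by (simp only: compose_eq cl[OF p])
  qed
  have \<alpha>': "\<alpha> \<in> alg_homs A B" and \<beta>': "\<beta> \<in> alg_homs A B"
    using \<alpha> \<beta> by (simp_all add: EQA_Hom_iff[OF x'(2)])
  have "\<alpha> a = \<beta> a" if a: "a \<in> carrier A" for a
  proof -
    obtain p where p: "p \<in> carrier (word_alg ?V)" "a = ?can (tensor_class ?V p)"
      using a surj by (auto simp only: tensor_alg_simps[OF V])
    have "word_map \<alpha> p = word_map \<beta> p"
      using p(1) eq by (intro word_map_cong[of _ A1]) (auto simp: restrict_def fun_eq_iff split: if_splits)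
    then show ?thesis
      using on_words[OF \<alpha>' p(1)] on_words[OF \<beta>' p(1)] p(2) by simp
  qed
  then show ?thesis
    using lin_mapsD(4)[OF alg_homsD(1)[OF \<alpha>']] lin_mapsD(4)[OF alg_homsD(1)[OF \<beta>']]
    by (intro extensionalityI)
qed

lemma tensor_lift_into_subspace:
  assumes V: "module base_field V" and B: "assoc_algebra B" "submodule B1 base_field B"
    and l: "l \<in> lin_maps V (subspace_of B B1)" and t: "t \<in> carrier (tensor_alg V)"
  shows "l \<in> lin_maps V B"
    and "tensor_lift V B l t =
      tensor_lift (subspace_of B B1) B (\<lambda>x\<in>B1. x) (tensor_map V (subspace_of B B1) l t)"
proof -
  show l': "l \<in> lin_maps V B"
    using lin_mapsD[OF l] subspace_subset[OF B] by (intro lin_mapsI) (auto simp: extensional_def)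
  obtain p where p: "p \<in> carrier (word_alg V)" "t = tensor_class V p"
    using t by (auto simp only: tensor_alg_simps[OF V])
  note W = module_subspace[OF B]
  show "tensor_lift V B l t =
      tensor_lift (subspace_of B B1) B (\<lambda>x\<in>B1. x) (tensor_map V (subspace_of B B1) l t)"
    using p word_map_word_alg[OF V W l p(1)]
    by (simp only: tensor_lift_class[OF V B(1) l'] tensor_map_class[OF V W l]
        tensor_lift_inclusion_class[OF B])
qed

text \<open>
  An arrow \<open>l : (A1, R) \<rightarrow> (B1, S)\<close> of \<open>Vect2\<close> extends to a homomorphism \<open>g\<close> from the tensor algebra
  of \<open>A1\<close> to \<open>B\<close>. As \<open>l\<^sup>\<otimes>\<^sup>2 R = S l\<^sup>\<otimes>\<^sup>2\<close>, the tensor square of \<open>l\<close> takes the image of \<open>R\<close> into the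
  image of \<open>S\<close>, which vanishes in \<open>B\<close>. So \<open>g\<close> vanishes on the ideal generated by the image of \<open>R\<close>,
  which is the kernel of the canonical epimorphism onto \<open>A\<close>, and \<open>g\<close> factors through \<open>A\<close>.
\<close>

lemma generators_full:
  assumes x: "((A1, A), R) \<in> Obj EQA" and y: "((B1, B), S) \<in> Obj EQA"
    and l: "l \<in> Hom Vect2 (subspace_of A A1, R) (subspace_of B B1, S)"
  obtains \<alpha> where "\<alpha> \<in> Hom EQA ((A1, A), R) ((B1, B), S)" "restrict \<alpha> A1 = l"
proof -
  note x' = EQA_ObjD[OF x] and y' = EQA_ObjD[OF y]
  let ?V = "subspace_of A A1" and ?W = "subspace_of B B1"
  note V = module_subspace[OF x'(1,2)] and W = module_subspace[OF y'(1,2)]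
  note T = assoc_algebra_tensor_alg[OF V] and TW = assoc_algebra_tensor_alg[OF W]
  let ?can = "tensor_lift ?V A (\<lambda>x\<in>A1. x)" and ?canB = "tensor_lift ?W B (\<lambda>x\<in>B1. x)"
  have l': "l \<in> lin_maps ?V ?W" "intertwines ?V R ?W S l" using l by (simp_all add: Vect2_simps)
  interpret T: ring "tensor_alg ?V" by (rule assoc_algebraD[OF T])
  interpret TW: ring "tensor_alg ?W" by (rule assoc_algebraD[OF TW])
  note into = tensor_lift_into_subspace[OF V y'(1,2) l'(1)]
  have lB: "l \<in> lin_maps ?V B" by (rule into(1)[OF T.zero_closed])
  define g where "g = tensor_lift ?V B l"
  have g: "g \<in> alg_homs (tensor_alg ?V) B"
    unfolding g_def by (rule tensor_lift_alg_hom[OF V y'(1) lB])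
  note sub = subsetD[OF tensor_power_subset[OF V, of 2]]
  note subW = subsetD[OF tensor_power_subset[OF W, of 2]]
  have "R ` carrier (tensor_power ?V 2) \<subseteq> {t \<in> carrier (tensor_alg ?V). g t = \<zero>\<^bsub>B\<^esub>}"
  proof clarify
    fix t assume t: "t \<in> carrier (tensor_power ?V 2)"
    note Rt = tensor2_endos_closed[OF x'(5) t]
    have lt: "tensor_power_map ?V ?W l 2 t \<in> carrier (tensor_power ?W 2)"
      by (rule tensor_power_map_closed[OF V W l'(1) t])
    have "g (R t) = ?canB (tensor_power_map ?V ?W l 2 (R t))"
      using into(2)[OF sub[OF Rt]] by (simp only: g_def tensor_power_map_eq[OF V W l'(1) Rt])
    also have "tensor_power_map ?V ?W l 2 (R t) = S (tensor_power_map ?V ?W l 2 t)"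
      using l'(2) t by (simp add: intertwines_iff)
    also have "S (tensor_power_map ?V ?W l 2 t) \<in> relation_ideal B B1"
      unfolding y'(6)
      by (rule subsetD[OF TW.genideal_self])
        (use tensor2_endos_closed[OF y'(5)] subW lt in auto)
    then have "?canB (S (tensor_power_map ?V ?W l 2 t)) = \<zero>\<^bsub>B\<^esub>"
      by (simp add: relation_ideal_eq[OF y'(1,2)])
    finally show "R t \<in> carrier (tensor_alg ?V) \<and> g (R t) = \<zero>\<^bsub>B\<^esub>" using sub[OF Rt] by blast
  qed
  then have "relation_ideal A A1 \<subseteq> {t \<in> carrier (tensor_alg ?V). g t = \<zero>\<^bsub>B\<^esub>}"
    unfolding x'(6) by (intro T.genideal_minimal ideal_alg_hom_kernel[OF T y'(1) g])
  then have ker: "g t = \<zero>\<^bsub>B\<^esub>" if "t \<in> carrier (tensor_alg ?V)" "?can t = \<zero>\<^bsub>A\<^esub>" for t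
    using that by (auto simp: relation_ideal_eq[OF x'(1,2)])
  have surj: "?can ` carrier (tensor_alg ?V) = carrier A"
    using x'(4) alg_generated_iff[OF x'(1,2)] by simp
  obtain \<alpha> where \<alpha>: "\<alpha> \<in> alg_homs A B" "\<And>t. t \<in> carrier (tensor_alg ?V) \<Longrightarrow> \<alpha> (?can t) = g t"
    using alg_hom_factor[OF T x'(1) y'(1) canonical_hom[OF x'(1,2)] surj g ker] by blast
  have \<alpha>l: "\<alpha> x = l x" if x: "x \<in> A1" for x
  proof -
    have p: "single [x] 1 \<in> carrier (word_alg ?V)" using x by simp
    then have "tensor_class ?V (single [x] 1) \<in> carrier (tensor_alg ?V)"
      by (simp only: tensor_alg_simps[OF V] imageI)
    then have "\<alpha> x = g (tensor_class ?V (single [x] 1))"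
      using \<alpha>(2) canonical_gen[OF x'(1,2) x] by metis
    also have "\<dots> = l x"
      using tensor_lift_class[OF V y'(1) lB p] lin_mapsD(1)[OF lB] x
      by (simp add: g_def word_map_single word_eval_generator[OF y'(1)])
    finally show ?thesis .
  qed
  have res: "restrict \<alpha> A1 = l"
    using \<alpha>l lin_mapsD(4)[OF l'(1)] by (intro extensionalityI[of _ A1]) auto
  have "\<alpha> ` A1 \<subseteq> B1" using \<alpha>l lin_mapsD(1)[OF l'(1)] by auto
  then have "\<alpha> \<in> Hom EQA ((A1, A), R) ((B1, B), S)"
    using \<alpha>(1) l by (simp add: EQA_Hom_iff[OF x'(2)] res)
  then show thesis using res by (rule that)
qed


section \<open>Essential surjectivity\<close>

text \<open>
  The algebra \<open>k \<oplus> V\<close> in which the product of any two elements of \<open>V\<close> is zero, the simplest algebra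
  that contains \<open>V\<close> and in which all quadratic relations hold.
\<close>

definition square_zero_alg :: "('k::field, 'v) module \<Rightarrow> ('k, 'k \<times> 'v) module"
  where "square_zero_alg V = \<lparr>carrier = UNIV \<times> carrier V,
    monoid.mult = (\<lambda>(a, x) (b, y). (a * b, (a \<odot>\<^bsub>V\<^esub> y) \<oplus>\<^bsub>V\<^esub> (b \<odot>\<^bsub>V\<^esub> x))), one = (1, \<zero>\<^bsub>V\<^esub>),
    ring.zero = (0, \<zero>\<^bsub>V\<^esub>), add = (\<lambda>(a, x) (b, y). (a + b, x \<oplus>\<^bsub>V\<^esub> y)),
    module.smult = (\<lambda>c (a, x). (c * a, c \<odot>\<^bsub>V\<^esub> x))\<rparr>"

lemma assoc_algebra_square_zero:
  fixes V :: "('k::field, 'v) module"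
  assumes V: "module base_field V"
  shows "assoc_algebra (square_zero_alg V)"
proof -
  interpret V: module base_field V by (rule V)
  have smult_closed: "c \<odot>\<^bsub>V\<^esub> x \<in> carrier V" if "x \<in> carrier V" for c x
    using that by simp
  note vs = V.smult_l_distr[simplified] V.smult_r_distr[simplified]
    V.smult_assoc1[simplified] V.smult_one[simplified] V.smult_l_null[simplified] V.smult_r_null[simplified]
  let ?A = "square_zero_alg V"
  have ab: "abelian_group ?A"
  proof (rule abelian_groupI)
    fix a assume "a \<in> carrier ?A"
    then show "\<exists>b\<in>carrier ?A. b \<oplus>\<^bsub>?A\<^esub> a = \<zero>\<^bsub>?A\<^esub>"
      by (intro bexI[of _ "(- fst a, \<ominus>\<^bsub>V\<^esub> snd a)"]) (auto simp: square_zero_alg_def V.l_neg)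
  qed (auto simp: square_zero_alg_def V.a_ac)
  have ring: "ring ?A"
  proof (rule ringI[OF ab])
    show "Group.monoid ?A"
      by (rule monoidI)
        (auto simp: square_zero_alg_def vs smult_closed V.a_ac mult_ac simp flip: V.smult_assoc1[simplified])
  qed (auto simp: square_zero_alg_def vs smult_closed V.a_ac algebra_simps)
  have "module base_field ?A"
  proof (rule moduleI[OF _ ab])
    show "cring (base_field :: 'k ring)" by (rule cring_from_type_algebra)
  qed (auto simp: square_zero_alg_def vs smult_closed algebra_simps)
  then show ?thesis
    using ring
    by (auto simp: assoc_algebra_def square_zero_alg_def vs smult_closed mult_ac
        simp flip: V.smult_assoc1[simplified])
qed

text \<open>
  Dividing the tensor algebra by relations of degree two does not identify elements of \<open>V\<close>. Instead
  of splitting the ideal into degrees, map to the square zero algebra: all of \<open>V \<otimes> V\<close>, hence the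
  ideal, goes to zero there, while \<open>V\<close> embeds.
\<close>

lemma generator_not_in_quadratic_ideal:
  fixes V :: "('k::field, 'v) module"
  assumes V: "module base_field V" and Q: "Q \<subseteq> carrier (tensor_power V 2)"
    and x: "x \<in> carrier V" and mem: "tensor_class V (single [x] 1) \<in> Idl\<^bsub>tensor_alg V\<^esub> Q"
  shows "x = \<zero>\<^bsub>V\<^esub>"
proof -
  let ?A = "square_zero_alg V"
  define f :: "'v \<Rightarrow> 'k \<times> 'v" where "f = (\<lambda>x\<in>carrier V. (0, x))"
  interpret V: module base_field V by (rule V)
  note A = assoc_algebra_square_zero[OF V]
  note T = assoc_algebra_tensor_alg[OF V]
  interpret T: ring "tensor_alg V" by (rule assoc_algebraD[OF T])
  interpret R: ring ?A by (rule assoc_algebraD[OF A])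
  interpret L: module base_field ?A by (rule assoc_algebraD[OF A])
  have f: "f \<in> lin_maps V ?A"
    by (intro lin_mapsI) (auto simp: square_zero_alg_def f_def)
  have prod: "f y \<otimes>\<^bsub>?A\<^esub> (f z \<otimes>\<^bsub>?A\<^esub> \<one>\<^bsub>?A\<^esub>) = \<zero>\<^bsub>?A\<^esub>" if "y \<in> carrier V" "z \<in> carrier V" for y z
    using that V.smult_l_null by (simp add: square_zero_alg_def f_def)
  have "tensor_lift V ?A f t = \<zero>\<^bsub>?A\<^esub>" if t: "t \<in> carrier (tensor_power V 2)" for t
  proof -
    obtain p where p: "keys p \<subseteq> words V 2" "p \<in> carrier (word_alg V)" "t = tensor_class V p"
      using t by (rule tensor_powerE)
    have "word_eval ?A (word_map f p) = \<zero>\<^bsub>?A\<^esub>"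
      using p(1)
    proof (induction p rule: poly_mapping_induct_single)
      case (add p w a)
      have fV: "f ` carrier V \<subseteq> carrier ?A" using lin_mapsD(1)[OF f] by auto
      obtain y z where w: "w = [y, z]" "y \<in> carrier V" "z \<in> carrier V"
        using add(2) by (auto simp: words_def numeral_2_eq_2 length_Suc_conv)
      have k: "map f w \<in> lists (carrier ?A)" "keys (word_map f p) \<subseteq> lists (carrier ?A)"
        using w lin_mapsD(1)[OF f] keys_word_map_lists[OF words_word_alg[OF add(1), simplified] fV] by simp_all
      have "word_eval ?A (single (map f w) a) = \<zero>\<^bsub>?A\<^esub>"
      proof -
        have "foldr (\<otimes>\<^bsub>?A\<^esub>) (map f w) \<one>\<^bsub>?A\<^esub> = \<zero>\<^bsub>?A\<^esub>"
          using w prod[of y z] by simp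
        then show ?thesis using L.smult_r_null[of a] by (simp only: word_eval_single[OF A k(1)]) simp
      qed
      then show ?case
        using add k by (simp add: word_map_add word_map_single word_eval_add[OF A])
    qed (simp add: word_eval_zero[OF A])
    then show ?thesis using tensor_lift_class[OF V A f p(2)] p(3) by simp
  qed
  then have "Q \<subseteq> {t \<in> carrier (tensor_alg V). tensor_lift V ?A f t = \<zero>\<^bsub>?A\<^esub>}"
    using Q tensor_power_subset[OF V, of 2] by blast
  then have "Idl\<^bsub>tensor_alg V\<^esub> Q \<subseteq> {t \<in> carrier (tensor_alg V). tensor_lift V ?A f t = \<zero>\<^bsub>?A\<^esub>}"
    by (intro T.genideal_minimal ideal_alg_hom_kernel[OF T A tensor_lift_alg_hom[OF V A f]])
  then have "tensor_lift V ?A f (tensor_class V (single [x] 1)) = \<zero>\<^bsub>?A\<^esub>" using mem by blast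
  moreover have "single [x] 1 \<in> carrier (word_alg V)" using x by simp
  ultimately have "f x = \<zero>\<^bsub>?A\<^esub>"
    using tensor_lift_class[OF V A f, of "single [x] 1"] x lin_mapsD(1)[OF f x]
    by (simp only: word_map_single list.map word_eval_generator[OF A])
  then show ?thesis using x by (simp add: square_zero_alg_def f_def)
qed

lemma lin_maps_inverse:
  assumes V: "module base_field V" and f: "f \<in> lin_maps V W" and bij: "bij_betw f (carrier V) (carrier W)"
  obtains g where "g \<in> lin_maps W V" "compose (carrier V) g f = (\<lambda>x\<in>carrier V. x)"
    "compose (carrier W) f g = (\<lambda>y\<in>carrier W. y)"
proof -
  interpret V: module base_field V by (rule V)
  note f' = lin_mapsD[OF f]
  define g where "g = (\<lambda>y\<in>carrier W. inv_into (carrier V) f y)"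
  have gf: "g (f x) = x" if "x \<in> carrier V" for x
    using that f' bij by (simp add: g_def bij_betw_inv_into_left)
  have fg: "\<exists>x\<in>carrier V. y = f x" if "y \<in> carrier W" for y
    using that bij by (auto simp: bij_betw_def)
  have "g \<in> lin_maps W V"
  proof (rule lin_mapsI)
    fix y assume "y \<in> carrier W"
    then obtain x where x: "x \<in> carrier V" "y = f x" using fg by blast
    show "g y \<in> carrier V" using x gf by simp
    show "g (c \<odot>\<^bsub>W\<^esub> y) = c \<odot>\<^bsub>V\<^esub> g y" for c
      using x by (simp add: gf flip: f'(3))
    fix z assume "z \<in> carrier W"
    then obtain x' where x': "x' \<in> carrier V" "z = f x'" using fg by blast
    show "g (y \<oplus>\<^bsub>W\<^esub> z) = g y \<oplus>\<^bsub>V\<^esub> g z"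
      using x x' by (simp add: gf flip: f'(2))
  qed (simp add: g_def)
  moreover have "compose (carrier V) g f = (\<lambda>x\<in>carrier V. x)"
    using gf by (auto simp: compose_def restrict_def fun_eq_iff)
  moreover have "compose (carrier W) f g = (\<lambda>y\<in>carrier W. y)"
    using fg gf by (fastforce simp: compose_def restrict_def fun_eq_iff)
  ultimately show thesis by (rule that)
qed

lemma lin_map_inj:
  assumes V: "module base_field V" and W: "module base_field W" and f: "f \<in> lin_maps V W"
    and ker: "\<And>x. x \<in> carrier V \<Longrightarrow> f x = \<zero>\<^bsub>W\<^esub> \<Longrightarrow> x = \<zero>\<^bsub>V\<^esub>"
  shows "inj_on f (carrier V)"
proof (rule inj_onI)
  interpret V: module base_field V by (rule V)
  interpret W: module base_field W by (rule W)
  fix x y assume x: "x \<in> carrier V" and y: "y \<in> carrier V" and "f x = f y"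
  then have "f (x \<ominus>\<^bsub>V\<^esub> y) = \<zero>\<^bsub>W\<^esub>"
    using lin_mapsD(1)[OF f] by (simp add: lin_maps_minus[OF f V W] W.minus_eq W.r_neg)
  then have "x \<ominus>\<^bsub>V\<^esub> y = \<zero>\<^bsub>V\<^esub>" using ker x y by (simp add: V.minus_eq)
  then show "x = y" using x y by (metis V.M.add.inv_closed V.M.add.r_inv V.M.add.r_cancel V.minus_eq)
qed

text \<open>
  Every algebra of the category must live in one universe, whereas the elements of the quotient of
  \<open>T\<close> by \<open>J\<close> are cosets. If \<open>T\<close> is not larger than the universe then the cosets inject into it, and
  the operations of the quotient are carried along this injection.
\<close>

lemma realise_quotient:
  fixes T :: "('k::field, 't) module"
  assumes T: "assoc_algebra T" and J: "ideal J T" and card: "carrier T \<lesssim> (UNIV :: 'u set)"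
  obtains A :: "('k, 'u) module" and h where "assoc_algebra A" "h \<in> alg_homs T A"
    "h ` carrier T = carrier A" "{t \<in> carrier T. h t = \<zero>\<^bsub>A\<^esub>} = J"
proof -
  interpret T: ring T by (rule assoc_algebraD[OF T])
  interpret TL: module base_field T by (rule assoc_algebraD[OF T])
  interpret J: ideal J T by (rule J)
  interpret Q: ring "T Quot J" by (rule J.quotient_is_ring)
  let ?q = "\<lambda>t. J +>\<^bsub>T\<^esub> t"
  note q = ring_hom_closed[OF J.rcos_ring_hom] ring_hom_add[OF J.rcos_ring_hom] ring_hom_mult[OF J.rcos_ring_hom]
  have "?q ` carrier T \<lesssim> carrier T" by (rule image_lepoll)
  then have "?q ` carrier T \<lesssim> (UNIV :: 'u set)" using card by (rule lepoll_trans)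
  then obtain \<phi> :: "'t set \<Rightarrow> 'u" where \<phi>: "inj_on \<phi> (?q ` carrier T)" by (auto simp: lepoll_def)
  define h where "h t = \<phi> (?q t)" for t
  have h_eq: "h s = h t \<longleftrightarrow> ?q s = ?q t" if "s \<in> carrier T" "t \<in> carrier T" for s t
    using that \<phi> by (auto simp: h_def inj_on_def)
  define k where "k = inv_into (carrier T) h"
  have k: "k (h t) \<in> carrier T" "?q (k (h t)) = ?q t" if "t \<in> carrier T" for t
  proof -
    show kT: "k (h t) \<in> carrier T" using that by (simp add: k_def inv_into_into)
    have "h (k (h t)) = h t" using that by (simp add: k_def f_inv_into_f)
    then show "?q (k (h t)) = ?q t" using that kT h_eq by blast
  qed
  define A where "A = \<lparr>carrier = h ` carrier T, monoid.mult = (\<lambda>a b. h (k a \<otimes>\<^bsub>T\<^esub> k b)), one = h \<one>\<^bsub>T\<^esub>,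
    ring.zero = h \<zero>\<^bsub>T\<^esub>, add = (\<lambda>a b. h (k a \<oplus>\<^bsub>T\<^esub> k b)), module.smult = (\<lambda>c a. h (c \<odot>\<^bsub>T\<^esub> k a))\<rparr>"
  have mult: "h s \<otimes>\<^bsub>A\<^esub> h t = h (s \<otimes>\<^bsub>T\<^esub> t)" and add: "h s \<oplus>\<^bsub>A\<^esub> h t = h (s \<oplus>\<^bsub>T\<^esub> t)"
    if "s \<in> carrier T" "t \<in> carrier T" for s t
    using that k by (simp_all add: A_def h_eq q)
  have smult: "c \<odot>\<^bsub>A\<^esub> h t = h (c \<odot>\<^bsub>T\<^esub> t)" if t: "t \<in> carrier T" for c t
  proof -
    have c1: "c \<odot>\<^bsub>T\<^esub> \<one>\<^bsub>T\<^esub> \<in> carrier T" by simp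
    \<comment> \<open>Writes a scalar multiple as a product, so that compatibility of cosets with products covers it.\<close>
    have scalar: "c \<odot>\<^bsub>T\<^esub> s = (c \<odot>\<^bsub>T\<^esub> \<one>\<^bsub>T\<^esub>) \<otimes>\<^bsub>T\<^esub> s" if "s \<in> carrier T" for s
      using that by (simp add: assoc_algebraD(3)[OF T])
    have "?q (c \<odot>\<^bsub>T\<^esub> k (h t)) = ?q (c \<odot>\<^bsub>T\<^esub> t)"
      using t k[OF t] c1 by (simp only: scalar[of "k (h t)"] scalar[of t] q)
    then show ?thesis using t k[OF t] by (simp add: A_def h_eq)
  qed
  have one: "\<one>\<^bsub>A\<^esub> = h \<one>\<^bsub>T\<^esub>" and zero: "\<zero>\<^bsub>A\<^esub> = h \<zero>\<^bsub>T\<^esub>" and carrier: "carrier A = h ` carrier T"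
    by (simp_all add: A_def)
  have A: "assoc_algebra A" by (rule assoc_algebra_image[OF T carrier add mult smult one zero])
  moreover have "restrict h (carrier T) \<in> alg_homs T A"
    by (intro alg_homsI lin_mapsI) (auto simp: carrier add mult smult one)
  moreover have "restrict h (carrier T) ` carrier T = carrier A" by (simp add: carrier)
  moreover have "{t \<in> carrier T. restrict h (carrier T) t = \<zero>\<^bsub>A\<^esub>} = J"
  proof -
    have "t \<in> J \<longleftrightarrow> ?q t = ?q \<zero>\<^bsub>T\<^esub>" if "t \<in> carrier T" for t
      using T.quotient_eq_iff_same_a_r_cos[OF J that T.zero_closed] that by (simp add: T.minus_eq)
    then show ?thesis using J.Icarr by (auto simp: zero h_eq)
  qed
  ultimately show thesis by (rule that)
qed

text \<open>
  Let \<open>h\<close> present \<open>A\<close> as the tensor algebra of \<open>V\<close> modulo the ideal generated by the image of \<open>R\<close>.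
  By the previous lemmas \<open>h\<close> is injective on \<open>V\<close>; let \<open>f : V \<rightarrow> A1\<close> be the resulting isomorphism onto
  the space of generators, and transport \<open>R\<close> along \<open>f\<close> to \<open>S\<close>. The induced isomorphism of tensor
  algebras intertwines \<open>h\<close> with the canonical map of \<open>A1\<close>, so it carries the kernel of \<open>h\<close> to the
  relation ideal, and the image of \<open>R\<close> to the image of \<open>S\<close>.
\<close>

lemma EQA_Obj_of_presentation:
  assumes VR: "(V, R) \<in> Obj Vect2" and A: "assoc_algebra A"
    and h: "h \<in> alg_homs (tensor_alg V) A" and surj: "h ` carrier (tensor_alg V) = carrier A"
    and ker: "{t \<in> carrier (tensor_alg V). h t = \<zero>\<^bsub>A\<^esub>} = Idl\<^bsub>tensor_alg V\<^esub> (R ` carrier (tensor_power V 2))"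
  obtains A1 S f where "((A1, A), S) \<in> Obj EQA" "is_iso Vect2 (subspace_of A A1, S) (V, R) f"
proof -
  have fV: "fin_dim V" and R: "R \<in> tensor2_endos V" using VR by (simp_all add: Vect2_simps)
  have V: "module base_field V" using fV by (rule fin_dim_module)
  interpret V: module base_field V by (rule V)
  note T = assoc_algebra_tensor_alg[OF V]
  interpret T: ring "tensor_alg V" by (rule assoc_algebraD[OF T])
  note Aring = assoc_algebraD(1)[OF A] and Amod = assoc_algebraD(2)[OF A]
  have RT: "R ` carrier (tensor_power V 2) \<subseteq> carrier (tensor_power V 2)"
    using tensor2_endos_closed[OF R] by blast
  have RT': "R ` carrier (tensor_power V 2) \<subseteq> carrier (tensor_alg V)"
    using RT tensor_power_subset[OF V] by blast
  define f where "f = compose (carrier V) h (tensor_gen V)"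
  have gen: "tensor_gen V \<in> lin_maps V (tensor_alg V)"
    unfolding tensor_gen_def by (rule tensor_gen_lin_map[OF V])
  have f: "f \<in> lin_maps V A"
    unfolding f_def by (rule lin_maps_compose[OF assoc_algebraD(2)[OF T] gen alg_homsD(1)[OF h] V])
  have f_gen: "h (tensor_class V (single [x] 1)) = f x" if "x \<in> carrier V" for x
    using that by (simp add: f_def compose_eq tensor_gen_def)
  define A1 where "A1 = f ` carrier V"
  let ?W = "subspace_of A A1"
  have A1: "submodule A1 base_field A"
    unfolding A1_def by (rule submodule_image[OF f V Amod])
  note W = module_subspace[OF A A1]
  note TW = assoc_algebra_tensor_alg[OF W]
  interpret TW: ring "tensor_alg ?W" by (rule assoc_algebraD[OF TW])
  have fW: "f \<in> lin_maps V ?W"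
    using lin_mapsD[OF f] by (intro lin_mapsI) (auto simp: A1_def extensional_def)
  have "inj_on f (carrier V)"
  proof (rule lin_map_inj[OF V Amod f])
    fix x assume x: "x \<in> carrier V" and "f x = \<zero>\<^bsub>A\<^esub>"
    then have "h (tensor_class V (single [x] 1)) = \<zero>\<^bsub>A\<^esub>" using f_gen by simp
    moreover have "tensor_class V (single [x] 1) \<in> carrier (tensor_alg V)"
      using x by (simp add: tensor_alg_simps[OF V])
    ultimately have "tensor_class V (single [x] 1) \<in> Idl\<^bsub>tensor_alg V\<^esub> (R ` carrier (tensor_power V 2))"
      using ker by blast
    then show "x = \<zero>\<^bsub>V\<^esub>" by (rule generator_not_in_quadratic_ideal[OF V RT x])
  qed
  then have "bij_betw f (carrier V) (carrier ?W)" by (simp add: bij_betw_def A1_def)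
  then obtain g where g: "g \<in> lin_maps ?W V"
    and gf: "compose (carrier V) g f = (\<lambda>x\<in>carrier V. x)"
    and fg: "compose (carrier ?W) f g = (\<lambda>y\<in>carrier ?W. y)"
    by (rule lin_maps_inverse[OF V fW])
  let ?f2 = "tensor_power_map V ?W f 2" and ?g2 = "tensor_power_map ?W V g 2"
  note f2 = tensor_power_map_closed[OF V W fW, of _ 2] and g2 = tensor_power_map_closed[OF W V g, of _ 2]
  have gf2: "?g2 (?f2 t) = t" if "t \<in> carrier (tensor_power V 2)" for t
    using tensor_power_map_compose[OF V W V fW g that] tensor_power_map_id[OF V that] by (simp only: gf)
  have fg2: "?f2 (?g2 t) = t" if "t \<in> carrier (tensor_power ?W 2)" for t
    using tensor_power_map_compose[OF W V W g fW that] tensor_power_map_id[OF W that] by (simp only: fg)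
  have fgT: "tensor_map V ?W f (tensor_map ?W V g t) = t" if "t \<in> carrier (tensor_alg ?W)" for t
    using tensor_map_compose[OF W V W g fW that] tensor_map_id[OF W that] by (simp only: fg)
  define S where "S = compose (carrier (tensor_power ?W 2)) ?f2 (compose (carrier (tensor_power ?W 2)) R ?g2)"
  have S_eq: "S t = ?f2 (R (?g2 t))" if "t \<in> carrier (tensor_power ?W 2)" for t
    using that by (simp add: S_def compose_eq)
  have S: "S \<in> tensor2_endos ?W"
    using R tensor_power_map_lin[OF V W fW] tensor_power_map_lin[OF W V g] module_tensor_power[OF V]
      module_tensor_power[OF W]
    unfolding S_def tensor2_endos_def by (meson lin_maps_compose)
  have ST: "S ` carrier (tensor_power ?W 2) \<subseteq> carrier (tensor_power ?W 2)"
    using tensor2_endos_closed[OF S] by blast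
  have ST': "S ` carrier (tensor_power ?W 2) \<subseteq> carrier (tensor_alg ?W)"
    using ST tensor_power_subset[OF W] by blast
  let ?can = "tensor_lift ?W A (\<lambda>x\<in>A1. x)"
  have h_can: "h t = ?can (tensor_map V ?W f t)" if t: "t \<in> carrier (tensor_alg V)" for t
  proof -
    obtain p where p: "p \<in> carrier (word_alg V)" "t = tensor_class V p"
      using t by (auto simp only: tensor_alg_simps[OF V])
    have "h t = tensor_lift V A f t"
      using alg_hom_tensor_class[OF V A h f_gen p(1)] tensor_lift_class[OF V A f p(1)] by (simp only: p(2))
    then show ?thesis using tensor_lift_into_subspace(2)[OF V A A1 fW t] by (simp only:)
  qed
  note tf = tensor_map_alg_hom[OF V W fW] and tg = tensor_map_alg_hom[OF W V g]
  note tf_closed = lin_mapsD(1)[OF alg_homsD(1)[OF tf]] and tg_closed = lin_mapsD(1)[OF alg_homsD(1)[OF tg]]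
  have gen_A: "alg_generated A A1 = carrier A"
    unfolding alg_generated_iff[OF A A1]
  proof
    show "?can ` carrier (tensor_alg ?W) \<subseteq> carrier A"
      using lin_mapsD(1)[OF alg_homsD(1)[OF canonical_hom[OF A A1]]] by blast
    show "carrier A \<subseteq> ?can ` carrier (tensor_alg ?W)"
      unfolding surj[symmetric] using h_can tf_closed by blast
  qed
  have rel: "relation_ideal A A1 = Idl\<^bsub>tensor_alg ?W\<^esub> (S ` carrier (tensor_power ?W 2))"
  proof
    have "S ` carrier (tensor_power ?W 2) \<subseteq> {t \<in> carrier (tensor_alg ?W). ?can t = \<zero>\<^bsub>A\<^esub>}"
    proof clarify
      fix t assume t: "t \<in> carrier (tensor_power ?W 2)"
      have Rt: "R (?g2 t) \<in> carrier (tensor_power V 2)"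
        using tensor2_endos_closed[OF R g2[OF t]] .
      have "R (?g2 t) \<in> Idl\<^bsub>tensor_alg V\<^esub> (R ` carrier (tensor_power V 2))"
        using T.genideal_self[OF RT'] g2[OF t] by blast
      then have "h (R (?g2 t)) = \<zero>\<^bsub>A\<^esub>" using ker by blast
      then have "?can (S t) = \<zero>\<^bsub>A\<^esub>"
        using h_can[OF subsetD[OF tensor_power_subset[OF V] Rt]]
        by (simp only: S_eq[OF t] tensor_power_map_eq[OF V W fW Rt])
      then show "S t \<in> carrier (tensor_alg ?W) \<and> ?can (S t) = \<zero>\<^bsub>A\<^esub>" using ST' t by blast
    qed
    then show "Idl\<^bsub>tensor_alg ?W\<^esub> (S ` carrier (tensor_power ?W 2)) \<subseteq> relation_ideal A A1"
      unfolding relation_ideal_eq[OF A A1]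
      by (intro TW.genideal_minimal ideal_alg_hom_kernel[OF TW A canonical_hom[OF A A1]])
    let ?I = "{s \<in> carrier (tensor_alg V). tensor_map V ?W f s \<in>
        Idl\<^bsub>tensor_alg ?W\<^esub> (S ` carrier (tensor_power ?W 2))}"
    have I: "ideal ?I (tensor_alg V)"
      by (rule ideal_alg_hom_vimage[OF T TW tf TW.genideal_ideal[OF ST']])
    have "R ` carrier (tensor_power V 2) \<subseteq> ?I"
    proof clarify
      fix s assume s: "s \<in> carrier (tensor_power V 2)"
      note Rs = tensor2_endos_closed[OF R s]
      have "tensor_map V ?W f (R s) = S (?f2 s)"
        using gf2[OF s] by (simp only: S_eq[OF f2[OF s]] tensor_power_map_eq[OF V W fW Rs])
      then have "tensor_map V ?W f (R s) \<in> Idl\<^bsub>tensor_alg ?W\<^esub> (S ` carrier (tensor_power ?W 2))"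
        using TW.genideal_self[OF ST'] f2[OF s] by auto
      then show "R s \<in> carrier (tensor_alg V) \<and> tensor_map V ?W f (R s) \<in>
          Idl\<^bsub>tensor_alg ?W\<^esub> (S ` carrier (tensor_power ?W 2))"
        using RT' s by blast
    qed
    then have le: "Idl\<^bsub>tensor_alg V\<^esub> (R ` carrier (tensor_power V 2)) \<subseteq> ?I"
      by (rule T.genideal_minimal[OF I])
    show "relation_ideal A A1 \<subseteq> Idl\<^bsub>tensor_alg ?W\<^esub> (S ` carrier (tensor_power ?W 2))"
    proof
      fix t assume "t \<in> relation_ideal A A1"
      then have t: "t \<in> carrier (tensor_alg ?W)" "?can t = \<zero>\<^bsub>A\<^esub>"
        by (simp_all add: relation_ideal_eq[OF A A1])
      have "h (tensor_map ?W V g t) = \<zero>\<^bsub>A\<^esub>"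
        using t by (simp only: h_can[OF tg_closed] fgT)
      then have "tensor_map ?W V g t \<in> ?I" using le ker tg_closed[OF t(1)] by blast
      then show "t \<in> Idl\<^bsub>tensor_alg ?W\<^esub> (S ` carrier (tensor_power ?W 2))"
        using fgT[OF t(1)] by simp
    qed
  qed
  have fin: "fin_dim ?W"
    by (rule fin_dim_image[OF fV W fW]) (simp add: A1_def)
  have "submodule (S ` carrier (tensor_power ?W 2)) base_field (tensor_power ?W 2)"
    using S unfolding tensor2_endos_def
    by (intro submodule_image module_tensor_power[OF W])
  then have obj: "((A1, A), S) \<in> Obj EQA"
    using A A1 fin gen_A rel S by (auto simp: EQA_simps QA_Obj_def)
  have "intertwines ?W S V R g"
    unfolding intertwines_iff
    using gf2[OF tensor2_endos_closed[OF R g2]] by (simp add: S_eq)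
  then have "g \<in> Hom Vect2 (?W, S) (V, R)" using g by (simp add: Vect2_simps)
  moreover have "intertwines V R ?W S f"
    unfolding intertwines_iff using f2 gf2 by (simp add: S_eq)
  then have "f \<in> Hom Vect2 (V, R) (?W, S)" using fW by (simp add: Vect2_simps)
  ultimately have "is_iso Vect2 (?W, S) (V, R) g"
    unfolding is_iso_def Vect2_simps(3,4) by (intro conjI bexI[of _ f] gf fg)
  with obj show thesis by (rule that)
qed

text \<open>
  Words in the elements of a finite spanning set \<open>S\<close> of \<open>V\<close> span the tensor algebra, and there are
  only countably many of them; so each tensor is determined by a sequence of scalars.
\<close>

lemma tensor_alg_lepoll:
  fixes V :: "('k::field, 'v) module"
  assumes "fin_dim V"
  shows "carrier (tensor_alg V) \<lesssim> (UNIV :: (nat \<Rightarrow> 'k) set)"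
proof -
  have V: "module base_field V" using assms by (rule fin_dim_module)
  note T = assoc_algebra_tensor_alg[OF V]
  interpret T: ring "tensor_alg V" by (rule assoc_algebraD[OF T])
  obtain S where S: "finite S" "S \<subseteq> carrier V" "lin_span V S = carrier V"
    using assms by (auto simp: fin_dim_def)
  define K where "K = {p :: 'v list \<Rightarrow>\<^sub>0 'k. keys p \<subseteq> lists S}"
  define M where "M = tensor_class V ` K"
  have KW: "p \<in> carrier (word_alg V)" if "p \<in> K" for p
    using that lists_mono[OF S(2)] by (auto simp: K_def)
  have M_sub: "M \<subseteq> carrier (tensor_alg V)"
    using KW by (auto simp only: M_def tensor_alg_simps[OF V])
  have M_add: "s \<oplus>\<^bsub>tensor_alg V\<^esub> t \<in> M" and M_mult: "s \<otimes>\<^bsub>tensor_alg V\<^esub> t \<in> M"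
    if st: "s \<in> M" "t \<in> M" for s t
  proof -
    obtain p q where "p \<in> K" "q \<in> K" "s = tensor_class V p" "t = tensor_class V q"
      using st by (auto simp: M_def)
    moreover from this have "p + q \<in> K" "p * q \<in> K"
      by (auto simp only: K_def mem_Collect_eq keys_add_subset keys_mult_lists)
    ultimately show "s \<oplus>\<^bsub>tensor_alg V\<^esub> t \<in> M" "s \<otimes>\<^bsub>tensor_alg V\<^esub> t \<in> M"
      using KW by (simp_all only: tensor_class_add[OF V] tensor_class_mult[OF V] M_def imageI)
  qed
  have M_smult: "c \<odot>\<^bsub>tensor_alg V\<^esub> t \<in> M" if t: "t \<in> M" for c t
  proof -
    obtain p where "p \<in> K" "t = tensor_class V p" using t by (auto simp: M_def)
    moreover from this have "single [] c * p \<in> K"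
      by (simp only: K_def mem_Collect_eq keys_scale_subset)
    ultimately show ?thesis using KW by (simp only: tensor_class_smult[OF V] M_def imageI)
  qed
  have M_zero: "\<zero>\<^bsub>tensor_alg V\<^esub> \<in> M" and M_one: "\<one>\<^bsub>tensor_alg V\<^esub> \<in> M"
    unfolding tensor_alg_simps[OF V] M_def by (intro imageI; simp add: K_def zero_list_def)+
  have subm: "submodule M base_field (tensor_alg V)"
    by (intro submodule_base_fieldI assoc_algebraD(2)[OF T] M_sub M_zero M_add M_smult)
  have subr: "subring M (tensor_alg V)"
    using M_sub M_one M_mult M_add
      module.submoduleE(3)[OF assoc_algebraD(2)[OF T] subm]
    by (intro T.subringI) auto
  have gen: "tensor_gen V \<in> lin_maps V (tensor_alg V)"
    unfolding tensor_gen_def by (rule tensor_gen_lin_map[OF V])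
  have "lin_span V S \<subseteq> {x \<in> carrier V. tensor_gen V x \<in> M}"
    using S(2) by (intro lin_span_least submodule_vimage[OF gen V assoc_algebraD(2)[OF T] subm])
      (auto simp: tensor_gen_def M_def K_def intro!: imageI)
  then have genM: "tensor_gen V ` carrier V \<subseteq> M" using S(3) by auto
  have "carrier (tensor_alg V) \<subseteq> M"
  proof
    fix t assume "t \<in> carrier (tensor_alg V)"
    then obtain p where p: "p \<in> carrier (word_alg V)" "t = tensor_class V p"
      by (auto simp only: tensor_alg_simps[OF V])
    have "keys p \<subseteq> lists (carrier V)" using p(1) by simp
    then have "keys (word_map (tensor_gen V) p) \<subseteq> lists M" by (rule keys_word_map_lists[OF _ genM])
    then have "word_eval (tensor_alg V) (word_map (tensor_gen V) p) \<in> M"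
      by (rule word_eval_in_subalgebra[OF T subr subm subset_refl])
    then show "t \<in> M" using p word_eval_tensor_gen[OF V p(1)] by (simp only:)
  qed
  then have "carrier (tensor_alg V) \<lesssim> K"
    unfolding M_def by (rule subset_image_lepoll)
  also have "K \<lesssim> (UNIV :: (nat \<Rightarrow> 'k) set)"
  proof -
    have ctbl: "countable (lists S)" using S(1) by (simp add: countable_finite)
    have "inj_on (\<lambda>p n. Poly_Mapping.lookup p (from_nat_into (lists S) n)) K"
    proof (rule inj_onI, rule poly_mapping_eqI)
      fix p q w
      assume p: "p \<in> K" and q: "q \<in> K"
        and eq: "(\<lambda>n. Poly_Mapping.lookup p (from_nat_into (lists S) n)) =
          (\<lambda>n. Poly_Mapping.lookup q (from_nat_into (lists S) n))"
      show "Poly_Mapping.lookup p w = Poly_Mapping.lookup q w"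
      proof (cases "w \<in> lists S")
        case True
        then obtain n where "from_nat_into (lists S) n = w"
          using from_nat_into_surj[OF ctbl] by blast
        then show ?thesis using fun_cong[OF eq, of n] by simp
      next
        case False
        then have "w \<notin> keys p" "w \<notin> keys q" using p q by (auto simp: K_def)
        then show ?thesis by (simp add: in_keys_iff)
      qed
    qed
    then show ?thesis by (auto simp: lepoll_def)
  qed
  finally show ?thesis .
qed

text \<open>
  Over a general field it suffices that the universe has room for the sequences of scalars, because
  they bound the size of the algebras to be constructed.
\<close>

theorem EQA_equivalent_Vect2:
  assumes "(UNIV :: (nat \<Rightarrow> 'k::field) set) \<lesssim> (UNIV :: 'u set)"
  shows "equivalent_categories (EQA :: (('k, 'u) eqa, 'u \<Rightarrow> 'u) cat) (Vect2 :: (('k, 'u) vect2, 'u \<Rightarrow> 'u) cat)"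
proof (rule equivalent_categories_if_fully_faithful_ess_surj[OF category_EQA category_Vect2 generators_functor])
  fix x y :: "('k, 'u) eqa"
  assume x: "x \<in> Obj EQA" and y: "y \<in> Obj EQA"
  obtain A1 A R where xA: "x = ((A1, A), R)" by (metis prod.exhaust)
  obtain B1 B S where yB: "y = ((B1, B), S)" by (metis prod.exhaust)
  show "inj_on (generators_map x y) (Hom EQA x y)"
    using generators_faithful[OF x[unfolded xA] y[unfolded yB]]
    by (auto simp: xA yB generators_map_def inj_on_def)
  show "Hom Vect2 (generators_obj x) (generators_obj y) \<subseteq> generators_map x y ` Hom EQA x y"
  proof
    fix l assume "l \<in> Hom Vect2 (generators_obj x) (generators_obj y)"
    then have "l \<in> Hom Vect2 (subspace_of A A1, R) (subspace_of B B1, S)"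
      by (simp add: xA yB generators_obj_def)
    then obtain \<alpha> where "\<alpha> \<in> Hom EQA x y" "restrict \<alpha> A1 = l"
      using generators_full[OF x[unfolded xA] y[unfolded yB]] unfolding xA yB by blast
    then show "l \<in> generators_map x y ` Hom EQA x y"
      by (intro image_eqI[of _ _ \<alpha>]) (simp_all add: xA generators_map_def)
  qed
next
  fix d :: "('k, 'u) vect2" assume d: "d \<in> Obj Vect2"
  obtain V R where VR: "d = (V, R)" by fastforce
  have fV: "fin_dim V" and R: "R \<in> tensor2_endos V" using d by (simp_all add: VR Vect2_simps)
  have V: "module base_field V" using fV by (rule fin_dim_module)
  note T = assoc_algebra_tensor_alg[OF V]
  have "R ` carrier (tensor_power V 2) \<subseteq> carrier (tensor_alg V)"
    using tensor2_endos_closed[OF R] tensor_power_subset[OF V] by blast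
  then have "ideal (Idl\<^bsub>tensor_alg V\<^esub> (R ` carrier (tensor_power V 2))) (tensor_alg V)"
    by (rule ring.genideal_ideal[OF assoc_algebraD(1)[OF T]])
  moreover have "carrier (tensor_alg V) \<lesssim> (UNIV :: 'u set)"
    using tensor_alg_lepoll[OF fV] assms by (rule lepoll_trans)
  ultimately obtain A :: "('k, 'u) module" and h where
    "assoc_algebra A" "h \<in> alg_homs (tensor_alg V) A" "h ` carrier (tensor_alg V) = carrier A"
    "{t \<in> carrier (tensor_alg V). h t = \<zero>\<^bsub>A\<^esub>} = Idl\<^bsub>tensor_alg V\<^esub> (R ` carrier (tensor_power V 2))"
    by (rule realise_quotient[OF T])
  then obtain A1 S f where "((A1, A), S) \<in> Obj EQA" "is_iso Vect2 (subspace_of A A1, S) (V, R) f"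
    by (rule EQA_Obj_of_presentation[OF d[unfolded VR]])
  then show "\<exists>c\<in>Obj EQA. \<exists>e. is_iso Vect2 (generators_obj c) d e"
    by (intro bexI[of _ "((A1, A), S)"] exI[of _ f]) (simp_all add: VR generators_obj_def)
qed

text \<open>
  A sequence of sets of numbers is coded by a single set of pairs of numbers.
\<close>

lemma sequences_lepoll:
  assumes "(UNIV :: 'k set) \<lesssim> (UNIV :: nat set set)"
  shows "(UNIV :: (nat \<Rightarrow> 'k) set) \<lesssim> (UNIV :: real set)"
proof -
  obtain \<phi> :: "'k \<Rightarrow> nat set" where \<phi>: "inj \<phi>" using assms by (auto simp: lepoll_def)
  have "inj (\<lambda>f. {prod_encode (n, m) | n m. m \<in> \<phi> (f n)})"
  proof (rule injI, rule ext)
    fix f g :: "nat \<Rightarrow> 'k" and n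
    assume eq: "{prod_encode (n, m) | n m. m \<in> \<phi> (f n)} = {prod_encode (n, m) | n m. m \<in> \<phi> (g n)}"
    have dec: "m \<in> \<phi> (f n) \<longleftrightarrow> prod_encode (n, m) \<in> {prod_encode (n, m) | n m. m \<in> \<phi> (f n)}" for f m
      by auto
    have "\<phi> (f n) = \<phi> (g n)" using eq dec[of _ f] dec[of _ g] by blast
    then show "f n = g n" using \<phi> by (simp add: inj_eq)
  qed
  then have "(UNIV :: (nat \<Rightarrow> 'k) set) \<lesssim> (UNIV :: nat set set)" by (auto simp: lepoll_def)
  then show ?thesis using nat_sets_eqpoll_reals by (rule lepoll_trans2)
qed

lemma complex_lepoll_nat_sets: "(UNIV :: complex set) \<lesssim> (UNIV :: nat set set)"
proof -
  have real: "(UNIV :: real set) \<lesssim> (UNIV :: nat set set)"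
    using nat_sets_eqpoll_reals by (simp add: eqpoll_imp_lepoll eqpoll_sym)
  have "inj (\<lambda>z n. if n = (0::nat) then Re z else Im z)"
    by (intro injI complex_eqI) (metis, metis zero_neq_one)
  then have "(UNIV :: complex set) \<lesssim> (UNIV :: (nat \<Rightarrow> real) set)" by (auto simp: lepoll_def)
  also have "\<dots> \<lesssim> (UNIV :: real set)" by (rule sequences_lepoll[OF real])
  finally show ?thesis using real by (rule lepoll_trans)
qed

theorem proposition1:
  assumes "\<exists>f :: real \<Rightarrow> 'u. inj f"
  shows "equivalent_categories
      (EQA :: ((real, 'u) eqa, 'u \<Rightarrow> 'u) cat) (Vect2 :: ((real, 'u) vect2, 'u \<Rightarrow> 'u) cat)
    \<and> equivalent_categories
      (EQA :: ((complex, 'u) eqa, 'u \<Rightarrow> 'u) cat) (Vect2 :: ((complex, 'u) vect2, 'u \<Rightarrow> 'u) cat)"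
proof -
  have u: "(UNIV :: real set) \<lesssim> (UNIV :: 'u set)" using assms by (auto simp: lepoll_def)
  have "(UNIV :: real set) \<lesssim> (UNIV :: nat set set)"
    using nat_sets_eqpoll_reals by (simp add: eqpoll_imp_lepoll eqpoll_sym)
  then show ?thesis
    using u by (blast intro: EQA_equivalent_Vect2 lepoll_trans sequences_lepoll complex_lepoll_nat_sets)
qed

end
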